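(* Let $(V,c)$ be a braided vector space over a field $K$. Then $(V,c,0)$ is a braided Lie algebra.
   Context: $K$ is a field, vector spaces are over $K$, $\otimes=\otimes_K$, and the name of an object also denotes its identity map. A braided vector space $(V,c)$ is a vector space $V$ with a $K$-linear map $c:V\otimes V\to V\otimes V$ such that $(c\otimes V)(V\otimes c)(c\otimes V)=(V\otimes c)(c\otimes V)(V\otimes c)$. A braided bialgebra $(B,m,u,\Delta,\varepsilon,c)$ is an algebra and coalgebra with a braiding $c$ on $B$ commuting with $m,u,\Delta,\varepsilon$ (i.e. $c(m\otimes B)=(B\otimes m)(c\otimes B)(B\otimes c)$, $c(B\otimes m)=(m\otimes B)(B\otimes c)(c\otimes B)$, $c(u\otimes B)=B\otimes u$, $c(B\otimes u)=u\otimes B$, and dually for $\Delta,\varepsilon$) such that $\Delta m=(m\otimes m)(B\otimes c\otimes B)(\Delta\otimes\Delta)$, with $\Delta,\varepsilon$ unital and $\varepsilon$ multiplicative. For a braided vector space $(V,c)$, $T=T(V,c)$ is the tensor algebra of $V$ with its unique braided bialgebra structure such that the braiding $c_T$ extends $c$ and $\Delta_T(v)=v\otimes1+1\otimes v$ for $v\in V$; it is graded by $T^n=V^{\otimes n}$, and $\Delta_T^{a,b}:V^{\otimes(a+b)}\to V^{\otimes a}\otimes V^{\otimes b}$ are the homogeneous components of $\Delta_T$. Put $E_n(V,c)=\bigcap_{a,b\ge1,\ a+b=n}\ker(\Delta_T^{a,b})$ for $n\ge2$ and $E(V,c)=\bigoplus_{n\ge2}E_n(V,c)$ (the primitive elements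 of degree at least two). The braiding $c_T$ restricts to maps $c_{E(V,c),V}:E(V,c)\otimes V\to V\otimes E(V,c)$ and $c_{V,E(V,c)}:V\otimes E(V,c)\to E(V,c)\otimes V$. A (braided) bracket on $(V,c)$ is a $K$-linear map $b:E(V,c)\to V$ with $c(b\otimes V)=(V\otimes b)c_{E(V,c),V}$ and $c(V\otimes b)=(b\otimes V)c_{V,E(V,c)}$. Its universal enveloping algebra is $U(V,c,b)=T(V,c)/\big((\mathrm{Id}-b)[E(V,c)]\big)$ (quotient by the generated two-sided ideal), with $i_U:V\to U(V,c,b)$ the restriction of the canonical projection. $(V,c,b)$ is a braided Lie algebra if $(V,c)$ is a braided vector space, $b$ is a bracket on $(V,c)$ and $i_U:V\to U(V,c,b)$ is injective. *)

theory Defs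
  imports "HOL-Algebra.Module" "HOL-Algebra.QuotRing"
begin

text \<open>Vector spaces over a field \<open>K\<close> are modules in the sense of \<^locale>\<open>module\<close>; the ring
  multiplication that a \<open>module\<close> record carries along is only used for algebras.\<close>

section \<open>Linear maps, quotients and free modules\<close>

text \<open>Linear maps are extensional (\<^const>\<open>undefined\<close> off the domain), so that a linear map is
  determined by its values on the domain.\<close>

definition linear_maps ::
  "('k, 'r) ring_scheme \<Rightarrow> ('k, 'v, 'm) module_scheme \<Rightarrow> ('k, 'w, 'n) module_scheme \<Rightarrow> ('v \<Rightarrow> 'w) set"
  where "linear_maps K V W = {f \<in> carrier V \<rightarrow>\<^sub>E carrier W.
     (\<forall>x\<in>carrier V. \<forall>y\<in>carrier V. f (x \<oplus>\<^bsub>V\<^esub> y) = f x \<oplus>\<^bsub>W\<^esub> f y) \<and>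
     (\<forall>a\<in>carrier K. \<forall>x\<in>carrier V. f (a \<odot>\<^bsub>V\<^esub> x) = a \<odot>\<^bsub>W\<^esub> f x)}"

text \<open>\<open>is_linear\<close> ignores the values off the domain; it is used for maps that are parameters, such as \<open>c\<close> and \<open>b\<close>.\<close>

definition is_linear ::
  "('k, 'r) ring_scheme \<Rightarrow> ('k, 'v, 'm) module_scheme \<Rightarrow> ('k, 'w, 'n) module_scheme \<Rightarrow> ('v \<Rightarrow> 'w) \<Rightarrow> bool"
  where "is_linear K V W f \<longleftrightarrow> restrict f (carrier V) \<in> linear_maps K V W"

definition span_of ::
  "('k, 'r) ring_scheme \<Rightarrow> ('k, 'v) module \<Rightarrow> 'v set \<Rightarrow> 'v set"
  where "span_of K V S = \<Inter>{H. submodule H K V \<and> S \<subseteq> H}"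

text \<open>The base field as a vector space over itself.\<close>

definition regular_module :: "('k, 'r) ring_scheme \<Rightarrow> ('k, 'k) module"
  where "regular_module K =
    \<lparr>carrier = carrier K, mult = mult K, one = one K, zero = zero K, add = add K, smult = mult K\<rparr>"

text \<open>Quotient by a submodule \<open>N\<close>, with elements the cosets of \<open>N\<close>. If \<open>M\<close> is an algebra and \<open>N\<close> a
  two-sided ideal, the ring part is the quotient ring \<open>M Quot N\<close>.\<close>

definition quotient :: "('k, 'v) module \<Rightarrow> 'v set \<Rightarrow> ('k, 'v set) module"
  where "quotient M N =
    ring.extend (M Quot N) (module.fields (\<lambda>a X. \<Union>x\<in>X. N +>\<^bsub>M\<^esub> (a \<odot>\<^bsub>M\<^esub> x)))"

definition free_module :: "('k, 'r) ring_scheme \<Rightarrow> 'x set \<Rightarrow> ('k, 'x \<Rightarrow> 'k) module"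
  where "free_module K X =
    \<lparr>carrier = {f. (\<forall>x. f x \<in> carrier K) \<and> (\<forall>x. x \<notin> X \<longrightarrow> f x = \<zero>\<^bsub>K\<^esub>) \<and> finite {x. f x \<noteq> \<zero>\<^bsub>K\<^esub>}},
     mult = undefined, one = undefined,
     zero = (\<lambda>x. \<zero>\<^bsub>K\<^esub>), add = (\<lambda>f g x. f x \<oplus>\<^bsub>K\<^esub> g x), smult = (\<lambda>a f x. a \<otimes>\<^bsub>K\<^esub> f x)\<rparr>"

definition single :: "('k, 'r) ring_scheme \<Rightarrow> 'x \<Rightarrow> 'x \<Rightarrow> 'k"
  where "single K x = (\<lambda>y. if y = x then \<one>\<^bsub>K\<^esub> else \<zero>\<^bsub>K\<^esub>)"


section \<open>Tensor products\<close>

type_synonym ('k, 'v, 'w) tens = "('v \<times> 'w \<Rightarrow> 'k) set"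

definition tensor_relations ::
  "('k, 'r) ring_scheme \<Rightarrow> ('k, 'v) module \<Rightarrow> ('k, 'w) module \<Rightarrow> ('v \<times> 'w \<Rightarrow> 'k) set"
  where "tensor_relations K V W = (let F = free_module K (carrier V \<times> carrier W) in
      {single K (v \<oplus>\<^bsub>V\<^esub> v', w) \<ominus>\<^bsub>F\<^esub> (single K (v, w) \<oplus>\<^bsub>F\<^esub> single K (v', w)) | v v' w.
         v \<in> carrier V \<and> v' \<in> carrier V \<and> w \<in> carrier W}
    \<union> {single K (v, w \<oplus>\<^bsub>W\<^esub> w') \<ominus>\<^bsub>F\<^esub> (single K (v, w) \<oplus>\<^bsub>F\<^esub> single K (v, w')) | v w w'.
         v \<in> carrier V \<and> w \<in> carrier W \<and> w' \<in> carrier W}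
    \<union> {single K (a \<odot>\<^bsub>V\<^esub> v, w) \<ominus>\<^bsub>F\<^esub> a \<odot>\<^bsub>F\<^esub> single K (v, w) | a v w.
         a \<in> carrier K \<and> v \<in> carrier V \<and> w \<in> carrier W}
    \<union> {single K (v, a \<odot>\<^bsub>W\<^esub> w) \<ominus>\<^bsub>F\<^esub> a \<odot>\<^bsub>F\<^esub> single K (v, w) | a v w.
         a \<in> carrier K \<and> v \<in> carrier V \<and> w \<in> carrier W})"

definition tensor_subspace ::
  "('k, 'r) ring_scheme \<Rightarrow> ('k, 'v) module \<Rightarrow> ('k, 'w) module \<Rightarrow> ('v \<times> 'w \<Rightarrow> 'k) set"
  where "tensor_subspace K V W =
    span_of K (free_module K (carrier V \<times> carrier W)) (tensor_relations K V W)"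

definition tensor ::
  "('k, 'r) ring_scheme \<Rightarrow> ('k, 'v) module \<Rightarrow> ('k, 'w) module \<Rightarrow> ('k, ('k, 'v, 'w) tens) module"
  where "tensor K V W =
    quotient (free_module K (carrier V \<times> carrier W)) (tensor_subspace K V W)"

definition pure_tensor ::
  "('k, 'r) ring_scheme \<Rightarrow> ('k, 'v) module \<Rightarrow> ('k, 'w) module \<Rightarrow> 'v \<Rightarrow> 'w \<Rightarrow> ('k, 'v, 'w) tens"
  where "pure_tensor K V W v w =
    tensor_subspace K V W +>\<^bsub>free_module K (carrier V \<times> carrier W)\<^esub> single K (v, w)"

text \<open>The linear map on \<open>V \<otimes> W\<close> induced by a bilinear map.\<close>

definition tensor_lift ::
  "('k, 'r) ring_scheme \<Rightarrow> ('k, 'v) module \<Rightarrow> ('k, 'w) module \<Rightarrow> ('k, 'u) module \<Rightarrow>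
   ('v \<Rightarrow> 'w \<Rightarrow> 'u) \<Rightarrow> ('k, 'v, 'w) tens \<Rightarrow> 'u"
  where "tensor_lift K V W U \<beta> = (THE h. h \<in> linear_maps K (tensor K V W) U \<and>
     (\<forall>v\<in>carrier V. \<forall>w\<in>carrier W. h (pure_tensor K V W v w) = \<beta> v w))"

subsection \<open>The universal property\<close>

text \<open>\<open>tensor_lift\<close> is well defined: every bilinear map factors uniquely through \<open>V \<otimes> W\<close>.\<close>

lemma free_module_simps:
  "carrier (free_module K X) = {f. (\<forall>x. f x \<in> carrier K) \<and> (\<forall>x. x \<notin> X \<longrightarrow> f x = \<zero>\<^bsub>K\<^esub>) \<and> finite {x. f x \<noteq> \<zero>\<^bsub>K\<^esub>}}"
  "zero (free_module K X) = (\<lambda>x. \<zero>\<^bsub>K\<^esub>)"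
  "add (free_module K X) = (\<lambda>f g x. f x \<oplus>\<^bsub>K\<^esub> g x)"
  "smult (free_module K X) = (\<lambda>a f x. a \<otimes>\<^bsub>K\<^esub> f x)"
  by (simp_all add: free_module_def)

lemma free_module_module:
  assumes "cring K" shows "module K (free_module K X)"
proof -
  interpret cring K by fact
  let ?F = "free_module K X"
  have addc: "f \<oplus>\<^bsub>?F\<^esub> g \<in> carrier ?F" if "f \<in> carrier ?F" "g \<in> carrier ?F" for f g
  proof -
    have "{x. f x \<oplus>\<^bsub>K\<^esub> g x \<noteq> \<zero>\<^bsub>K\<^esub>} \<subseteq> {x. f x \<noteq> \<zero>\<^bsub>K\<^esub>} \<union> {x. g x \<noteq> \<zero>\<^bsub>K\<^esub>}" by auto
    then show ?thesis using that by (auto simp: free_module_simps dest: finite_subset)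
  qed
  have smc: "a \<odot>\<^bsub>?F\<^esub> g \<in> carrier ?F" if "a \<in> carrier K" "g \<in> carrier ?F" for a g
  proof -
    have "{x. a \<otimes>\<^bsub>K\<^esub> g x \<noteq> \<zero>\<^bsub>K\<^esub>} \<subseteq> {x. g x \<noteq> \<zero>\<^bsub>K\<^esub>}" using that by auto
    then show ?thesis using that by (auto simp: free_module_simps dest: finite_subset)
  qed
  have "abelian_group ?F"
  proof (rule abelian_groupI)
    fix f assume f: "f \<in> carrier ?F"
    have "(\<ominus>\<^bsub>K\<^esub> \<one>\<^bsub>K\<^esub>) \<odot>\<^bsub>?F\<^esub> f \<in> carrier ?F" using smc f by auto
    moreover have "((\<ominus>\<^bsub>K\<^esub> \<one>\<^bsub>K\<^esub>) \<odot>\<^bsub>?F\<^esub> f) \<oplus>\<^bsub>?F\<^esub> f = \<zero>\<^bsub>?F\<^esub>"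
      using f by (auto simp: free_module_simps l_minus l_neg)
    ultimately show "\<exists>y\<in>carrier ?F. y \<oplus>\<^bsub>?F\<^esub> f = \<zero>\<^bsub>?F\<^esub>" by blast
  qed (use addc in \<open>auto simp: free_module_simps a_ac\<close>)
  then show ?thesis
    by (intro moduleI) (use smc assms in \<open>auto simp: free_module_simps l_distr r_distr m_assoc\<close>)
qed

lemma single_closed: assumes "cring K" "x \<in> X" shows "single K x \<in> carrier (free_module K X)"
proof -
  interpret cring K by fact
  have "{y. single K x y \<noteq> \<zero>\<^bsub>K\<^esub>} \<subseteq> {x}" by (auto simp: single_def)
  then show ?thesis using assms by (auto simp: free_module_simps single_def dest: finite_subset)
qed

lemma span_submodule:
  assumes "module K M" "S \<subseteq> carrier M" shows "submodule (span_of K M S) K M"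
proof -
  interpret module K M by fact
  have c: "submodule (carrier M) K M" by (rule carrier_is_submodule)
  show ?thesis unfolding span_of_def
  proof (rule submoduleI)
    show "\<Inter>{H. submodule H K M \<and> S \<subseteq> H} \<subseteq> carrier M" using c assms by auto
  qed (auto dest: submoduleE subgroup.one_closed[OF submodule.axioms(1), simplified])
qed

lemma quotient_simps:
  "carrier (quotient M N) = a_rcosets\<^bsub>M\<^esub> N" "zero (quotient M N) = N"
  "add (quotient M N) = set_add M"
  "smult (quotient M N) = (\<lambda>a X. \<Union>x\<in>X. N +>\<^bsub>M\<^esub> (a \<odot>\<^bsub>M\<^esub> x))"
  "monoid.mult (quotient M N) = rcoset_mult M N" "one (quotient M N) = N +>\<^bsub>M\<^esub> \<one>\<^bsub>M\<^esub>"
  by (simp_all add: quotient_def FactRing_def ring.defs module.defs)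

lemma rcosets_iff: "X \<in> a_rcosets\<^bsub>M\<^esub> N \<longleftrightarrow> (\<exists>x\<in>carrier M. X = N +>\<^bsub>M\<^esub> x)"
  by (auto simp: A_RCOSETS_def RCOSETS_def a_r_coset_def)

lemma submodule_abelian_subgroup:
  assumes "module K M" "submodule N K M" shows "abelian_subgroup N M"
proof -
  interpret module K M by fact
  show ?thesis
    by (intro abelian_subgroupI3 additive_subgroup.intro is_abelian_group)
       (use assms(2) M.abelian_group_axioms in \<open>auto dest: submodule.axioms(1)\<close>)
qed

lemma smult_coset:
  assumes "module K M" "submodule N K M" "a \<in> carrier K" "x \<in> carrier M"
  shows "(\<Union>y\<in>N +>\<^bsub>M\<^esub> x. N +>\<^bsub>M\<^esub> (a \<odot>\<^bsub>M\<^esub> y)) = N +>\<^bsub>M\<^esub> (a \<odot>\<^bsub>M\<^esub> x)"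
proof -
  interpret module K M by fact
  interpret N: abelian_subgroup N M using submodule_abelian_subgroup assms by blast
  have "N +>\<^bsub>M\<^esub> (a \<odot>\<^bsub>M\<^esub> y) = N +>\<^bsub>M\<^esub> (a \<odot>\<^bsub>M\<^esub> x)" if y: "y \<in> N +>\<^bsub>M\<^esub> x" for y
  proof -
    have yc: "y \<in> carrier M" using N.a_elemrcos_carrier assms y by blast
    have "y \<oplus>\<^bsub>M\<^esub> \<ominus>\<^bsub>M\<^esub> x \<in> N" using N.a_rcos_module_imp assms(4) y by blast
    then have "a \<odot>\<^bsub>M\<^esub> (y \<oplus>\<^bsub>M\<^esub> \<ominus>\<^bsub>M\<^esub> x) \<in> N" using submodule.smult_closed assms by metis
    then have "a \<odot>\<^bsub>M\<^esub> y \<oplus>\<^bsub>M\<^esub> \<ominus>\<^bsub>M\<^esub> (a \<odot>\<^bsub>M\<^esub> x) \<in> N"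
      using assms yc smult_r_distr smult_r_minus by force
    then have "a \<odot>\<^bsub>M\<^esub> y \<in> N +>\<^bsub>M\<^esub> (a \<odot>\<^bsub>M\<^esub> x)"
      using N.a_rcos_module_rev assms yc by auto
    then show ?thesis using a_repr_independence assms N.a_subgroup by (metis smult_closed)
  qed
  moreover have "x \<in> N +>\<^bsub>M\<^esub> x" using N.a_rcos_self assms by blast
  ultimately show ?thesis by blast
qed

lemma quotient_module:
  fixes M :: "('k, 'a) module"
  assumes "module K M" "submodule N K M" shows "module K (quotient M N)"
proof -
  interpret module K M by fact
  interpret N: abelian_subgroup N M using submodule_abelian_subgroup assms by blast
  have ag: "abelian_group (quotient M N)"
  proof (rule abelian_groupI)
    have z: "N +>\<^bsub>M\<^esub> \<zero>\<^bsub>M\<^esub> = N" by (simp add: N.a_subset)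
    show "\<zero>\<^bsub>quotient M N\<^esub> \<in> carrier (quotient M N)"
      using z by (auto simp: quotient_simps rcosets_iff)
    show "\<zero>\<^bsub>quotient M N\<^esub> \<oplus>\<^bsub>quotient M N\<^esub> x = x" if "x \<in> carrier (quotient M N)" for x
      using that N.a_rcos_sum[of "\<zero>\<^bsub>M\<^esub>"] z by (auto simp: quotient_simps rcosets_iff)
    show "\<exists>y\<in>carrier (quotient M N). y \<oplus>\<^bsub>quotient M N\<^esub> x = \<zero>\<^bsub>quotient M N\<^esub>"
      if x: "x \<in> carrier (quotient M N)" for x
    proof -
      obtain u where u: "u \<in> carrier M" "x = N +>\<^bsub>M\<^esub> u" using x by (auto simp: quotient_simps rcosets_iff)
      have "(N +>\<^bsub>M\<^esub> (\<ominus>\<^bsub>M\<^esub> u)) \<oplus>\<^bsub>quotient M N\<^esub> x = \<zero>\<^bsub>quotient M N\<^esub>"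
        using u z by (simp add: quotient_simps N.a_rcos_sum M.l_neg)
      moreover have "N +>\<^bsub>M\<^esub> (\<ominus>\<^bsub>M\<^esub> u) \<in> carrier (quotient M N)"
        using u by (auto simp: quotient_simps rcosets_iff)
      ultimately show ?thesis by blast
    qed
  qed (auto simp: quotient_simps rcosets_iff N.a_rcos_sum M.a_ac)
  have s: "a \<odot>\<^bsub>quotient M N\<^esub> (N +>\<^bsub>M\<^esub> x) = N +>\<^bsub>M\<^esub> (a \<odot>\<^bsub>M\<^esub> x)"
    if "a \<in> carrier K" "x \<in> carrier M" for a x
    using smult_coset[OF assms that] by (simp add: quotient_simps)
  show ?thesis
    by (intro moduleI ag R.is_cring)
      (auto simp: quotient_simps(1,3) rcosets_iff s N.a_rcos_sum smult_l_distr smult_r_distr smult_assoc1)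
qed

lemma quotient_proj:
  assumes "module K M" "submodule N K M"
  shows "x \<in> carrier M \<Longrightarrow> N +>\<^bsub>M\<^esub> x \<in> carrier (quotient M N)"
    "x \<in> carrier M \<Longrightarrow> y \<in> carrier M \<Longrightarrow> (N +>\<^bsub>M\<^esub> x) \<oplus>\<^bsub>quotient M N\<^esub> (N +>\<^bsub>M\<^esub> y) = N +>\<^bsub>M\<^esub> (x \<oplus>\<^bsub>M\<^esub> y)"
    "a \<in> carrier K \<Longrightarrow> x \<in> carrier M \<Longrightarrow> a \<odot>\<^bsub>quotient M N\<^esub> (N +>\<^bsub>M\<^esub> x) = N +>\<^bsub>M\<^esub> (a \<odot>\<^bsub>M\<^esub> x)"
proof -
  interpret module K M by fact
  interpret N: abelian_subgroup N M using submodule_abelian_subgroup assms by blast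
  show "x \<in> carrier M \<Longrightarrow> N +>\<^bsub>M\<^esub> x \<in> carrier (quotient M N)"
    by (auto simp: quotient_simps rcosets_iff)
  show "x \<in> carrier M \<Longrightarrow> y \<in> carrier M \<Longrightarrow> (N +>\<^bsub>M\<^esub> x) \<oplus>\<^bsub>quotient M N\<^esub> (N +>\<^bsub>M\<^esub> y) = N +>\<^bsub>M\<^esub> (x \<oplus>\<^bsub>M\<^esub> y)"
    by (simp add: quotient_simps N.a_rcos_sum)
  show "a \<in> carrier K \<Longrightarrow> x \<in> carrier M \<Longrightarrow> a \<odot>\<^bsub>quotient M N\<^esub> (N +>\<^bsub>M\<^esub> x) = N +>\<^bsub>M\<^esub> (a \<odot>\<^bsub>M\<^esub> x)"
    by (simp add: quotient_simps smult_coset[OF assms])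
qed

lemma free_induct:
  assumes K: "cring K" and f: "f \<in> carrier (free_module K X)"
    and H: "submodule H K (free_module K X)" and S: "\<And>x. x \<in> X \<Longrightarrow> single K x \<in> H"
  shows "f \<in> H"
proof -
  interpret cring K by fact
  interpret F: module K "free_module K X" by (rule free_module_module[OF K])
  have "finite A \<Longrightarrow> f \<in> carrier (free_module K X) \<Longrightarrow> {x. f x \<noteq> \<zero>\<^bsub>K\<^esub>} = A \<Longrightarrow> f \<in> H" for A f
  proof (induction A arbitrary: f rule: finite_induct)
    case empty
    then have "f = \<zero>\<^bsub>free_module K X\<^esub>" by (auto simp: free_module_simps)
    then show ?case using subgroup.one_closed[OF submodule.axioms(1)[OF H]] by simp
  next
    case (insert x A)
    let ?g = "f(x := \<zero>\<^bsub>K\<^esub>)"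
    have xX: "x \<in> X" using insert by (auto simp: free_module_simps)
    have sg: "{y. ?g y \<noteq> \<zero>\<^bsub>K\<^esub>} = A" using insert by auto
    then have g: "?g \<in> carrier (free_module K X)" using insert by (auto simp: free_module_simps)
    then have gH: "?g \<in> H" using insert sg by blast
    have fx: "f x \<in> carrier K" using insert.prems(1) by (auto simp: free_module_simps)
    have "f = ?g \<oplus>\<^bsub>free_module K X\<^esub> (f x \<odot>\<^bsub>free_module K X\<^esub> single K x)"
      using insert.prems(1) fx by (auto simp: free_module_simps single_def fun_eq_iff)
    moreover have "\<dots> \<in> H" using F.submoduleE(4,5)[OF H] gH fx S[OF xX] by blast
    ultimately show ?case by metis
  qed
  then show ?thesis using f by (auto simp: free_module_simps)
qed

lemma tensor_sub:
  assumes "module K V" "module K W"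
  shows "tensor_relations K V W \<subseteq> carrier (free_module K (carrier V \<times> carrier W))"
    and "submodule (tensor_subspace K V W) K (free_module K (carrier V \<times> carrier W))"
    and "tensor_relations K V W \<subseteq> tensor_subspace K V W"
proof -
  interpret V: module K V by fact
  interpret W: module K W by fact
  interpret F: module K "free_module K (carrier V \<times> carrier W)" by (rule free_module_module) (rule V.R.is_cring)
  note [simp] = single_closed[OF V.R.is_cring]
  show r: "tensor_relations K V W \<subseteq> carrier (free_module K (carrier V \<times> carrier W))"
    unfolding tensor_relations_def Let_def by (auto intro!: F.minus_closed)
  show "submodule (tensor_subspace K V W) K (free_module K (carrier V \<times> carrier W))"
    unfolding tensor_subspace_def by (rule span_submodule[OF F.module_axioms r])
  show "tensor_relations K V W \<subseteq> tensor_subspace K V W"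
    unfolding tensor_subspace_def span_of_def by auto
qed

lemma free_lift:
  assumes K: "cring K" and U: "module K U" and b: "\<beta> \<in> X \<rightarrow> carrier U"
  obtains \<Phi> where "\<Phi> \<in> carrier (free_module K X) \<rightarrow> carrier U"
    "\<And>f g. f \<in> carrier (free_module K X) \<Longrightarrow> g \<in> carrier (free_module K X) \<Longrightarrow> \<Phi> (f \<oplus>\<^bsub>free_module K X\<^esub> g) = \<Phi> f \<oplus>\<^bsub>U\<^esub> \<Phi> g"
    "\<And>a f. a \<in> carrier K \<Longrightarrow> f \<in> carrier (free_module K X) \<Longrightarrow> \<Phi> (a \<odot>\<^bsub>free_module K X\<^esub> f) = a \<odot>\<^bsub>U\<^esub> \<Phi> f"
    "\<And>x. x \<in> X \<Longrightarrow> \<Phi> (single K x) = \<beta> x"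
proof
  interpret U: module K U by fact
  let ?F = "free_module K X"
  interpret F: module K ?F by (rule free_module_module[OF K])
  define \<Phi> where "\<Phi> f = finsum U (\<lambda>x. f x \<odot>\<^bsub>U\<^esub> \<beta> x) {x. f x \<noteq> \<zero>\<^bsub>K\<^esub>}" for f
  have sup: "{x. f x \<noteq> \<zero>\<^bsub>K\<^esub>} \<subseteq> X" "finite {x. f x \<noteq> \<zero>\<^bsub>K\<^esub>}" "f x \<in> carrier K" if "f \<in> carrier ?F" for f x
    using that by (auto simp: free_module_simps)
  have ext: "\<Phi> f = finsum U (\<lambda>x. f x \<odot>\<^bsub>U\<^esub> \<beta> x) A"
    if "f \<in> carrier ?F" "finite A" "{x. f x \<noteq> \<zero>\<^bsub>K\<^esub>} \<subseteq> A" "A \<subseteq> X" for f A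
    unfolding \<Phi>_def
    by (rule U.add.finprod_mono_neutral_cong_left) (use that b sup in \<open>auto intro!: U.smult_l_null U.smult_closed\<close>)
  have cl: "(\<lambda>x. f x \<odot>\<^bsub>U\<^esub> \<beta> x) \<in> A \<rightarrow> carrier U" if "f \<in> carrier ?F" "A \<subseteq> X" for f A
    using that b sup by (auto intro!: U.smult_closed)
  show "\<Phi> \<in> carrier ?F \<rightarrow> carrier U" unfolding \<Phi>_def using cl sup(1) by (auto intro!: U.finsum_closed)
  show "\<Phi> (f \<oplus>\<^bsub>?F\<^esub> g) = \<Phi> f \<oplus>\<^bsub>U\<^esub> \<Phi> g" if f: "f \<in> carrier ?F" and g: "g \<in> carrier ?F" for f g
  proof -
    let ?A = "{x. f x \<noteq> \<zero>\<^bsub>K\<^esub>} \<union> {x. g x \<noteq> \<zero>\<^bsub>K\<^esub>}"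
    have A: "finite ?A" "?A \<subseteq> X" using f g sup by auto
    have fg: "f \<oplus>\<^bsub>?F\<^esub> g \<in> carrier ?F" using f g by simp
    have "\<Phi> (f \<oplus>\<^bsub>?F\<^esub> g) = finsum U (\<lambda>x. (f \<oplus>\<^bsub>?F\<^esub> g) x \<odot>\<^bsub>U\<^esub> \<beta> x) ?A"
      by (rule ext[OF fg A(1) _ A(2)]) (auto simp: free_module_simps)
    also have "\<dots> = finsum U (\<lambda>x. f x \<odot>\<^bsub>U\<^esub> \<beta> x \<oplus>\<^bsub>U\<^esub> g x \<odot>\<^bsub>U\<^esub> \<beta> x) ?A"
      by (rule U.finsum_cong') (use A b sup f g in \<open>auto simp: free_module_simps(3) intro!: U.smult_l_distr U.smult_closed U.add.m_closed\<close>)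
    also have "\<dots> = \<Phi> f \<oplus>\<^bsub>U\<^esub> \<Phi> g"
      unfolding ext[OF f A(1) _ A(2), simplified] ext[OF g A(1) _ A(2), simplified]
      by (rule U.finsum_addf) (use cl f g A in auto)
    finally show ?thesis .
  qed
  show "\<Phi> (a \<odot>\<^bsub>?F\<^esub> f) = a \<odot>\<^bsub>U\<^esub> \<Phi> f" if a: "a \<in> carrier K" and f: "f \<in> carrier ?F" for a f
  proof -
    let ?A = "{x. f x \<noteq> \<zero>\<^bsub>K\<^esub>}"
    have A: "finite ?A" "?A \<subseteq> X" using f sup by auto
    have af: "a \<odot>\<^bsub>?F\<^esub> f \<in> carrier ?F" using a f by simp
    have "\<Phi> (a \<odot>\<^bsub>?F\<^esub> f) = finsum U (\<lambda>x. (a \<odot>\<^bsub>?F\<^esub> f) x \<odot>\<^bsub>U\<^esub> \<beta> x) ?A"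
      by (rule ext[OF af A(1) _ A(2)]) (use a in \<open>auto simp: free_module_simps\<close>)
    also have "\<dots> = finsum U (\<lambda>x. a \<odot>\<^bsub>U\<^esub> (f x \<odot>\<^bsub>U\<^esub> \<beta> x)) ?A"
      by (rule U.finsum_cong') (use A a b sup f in \<open>auto simp: free_module_simps(4) intro!: U.smult_assoc1 U.smult_closed\<close>)
    also have "\<dots> = a \<odot>\<^bsub>U\<^esub> \<Phi> f"
      unfolding \<Phi>_def by (rule U.finsum_smult_ldistr[symmetric]) (use cl f A a in auto)
    finally show ?thesis .
  qed
  show "\<Phi> (single K x) = \<beta> x" if x: "x \<in> X" for x
  proof -
    have "\<Phi> (single K x) = finsum U (\<lambda>y. single K x y \<odot>\<^bsub>U\<^esub> \<beta> y) {x}"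
      by (rule ext[OF single_closed[OF K x]]) (use x in \<open>auto simp: single_def\<close>)
    also have "\<dots> = \<beta> x" using x b by (auto simp: single_def Pi_def)
    finally show ?thesis .
  qed
qed

lemma pure_tensor_props:
  assumes "module K V" "module K W"
  shows "module K (tensor K V W)"
    "\<And>v w. v \<in> carrier V \<Longrightarrow> w \<in> carrier W \<Longrightarrow> pure_tensor K V W v w \<in> carrier (tensor K V W)"
proof -
  interpret V: module K V by fact
  note s = tensor_sub[OF assms]
  note F = free_module_module[OF V.R.is_cring, of "carrier V \<times> carrier W"]
  show "module K (tensor K V W)" unfolding tensor_def by (rule quotient_module[OF F s(2)])
  show "\<And>v w. v \<in> carrier V \<Longrightarrow> w \<in> carrier W \<Longrightarrow> pure_tensor K V W v w \<in> carrier (tensor K V W)"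
    unfolding tensor_def pure_tensor_def by (intro quotient_proj(1)[OF F s(2)] single_closed V.R.is_cring) auto
qed

lemma tensor_lift_unique:
  assumes "module K V" "module K W" "module K U"
    and h: "h \<in> linear_maps K (tensor K V W) U" "h' \<in> linear_maps K (tensor K V W) U"
    and eq: "\<And>v w. v \<in> carrier V \<Longrightarrow> w \<in> carrier W \<Longrightarrow> h (pure_tensor K V W v w) = h' (pure_tensor K V W v w)"
  shows "h = h'"
proof -
  interpret V: module K V by fact
  interpret U: module K U by fact
  let ?F = "free_module K (carrier V \<times> carrier W)"
  let ?N = "tensor_subspace K V W"
  let ?p = "\<lambda>f. ?N +>\<^bsub>?F\<^esub> f"
  note s = tensor_sub[OF assms(1,2)]
  interpret F: module K ?F by (rule free_module_module[OF V.R.is_cring])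
  note p = quotient_proj[OF F.module_axioms s(2), folded tensor_def]
  have hl: "h \<in> carrier (tensor K V W) \<rightarrow> carrier U" "h' \<in> carrier (tensor K V W) \<rightarrow> carrier U"
    using h by (auto simp: linear_maps_def PiE_def)
  have ha: "g (x \<oplus>\<^bsub>tensor K V W\<^esub> y) = g x \<oplus>\<^bsub>U\<^esub> g y" if "g \<in> {h,h'}" "x \<in> carrier (tensor K V W)" "y \<in> carrier (tensor K V W)" for g x y
    using h that by (auto simp: linear_maps_def)
  have hs: "g (a \<odot>\<^bsub>tensor K V W\<^esub> y) = a \<odot>\<^bsub>U\<^esub> g y" if "g \<in> {h,h'}" "a \<in> carrier K" "y \<in> carrier (tensor K V W)" for g a y
    using h that by (auto simp: linear_maps_def)
  let ?H = "{f \<in> carrier ?F. h (?p f) = h' (?p f)}"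
  have sm: "a \<odot>\<^bsub>?F\<^esub> f \<in> ?H" if "a \<in> carrier K" "f \<in> ?H" for a f
  proof -
    have f: "f \<in> carrier ?F" "h (?p f) = h' (?p f)" using that by auto
    have "h (?p (a \<odot>\<^bsub>?F\<^esub> f)) = h' (?p (a \<odot>\<^bsub>?F\<^esub> f))"
      unfolding p(3)[OF that(1) f(1), symmetric]
      using hs[of h a "?p f"] hs[of h' a "?p f"] that(1) p(1)[OF f(1)] f(2) by simp
    then show ?thesis using F.smult_closed[OF that(1) f(1)] by blast
  qed
  have ad: "f \<oplus>\<^bsub>?F\<^esub> g \<in> ?H" if "f \<in> ?H" "g \<in> ?H" for f g
  proof -
    have f: "f \<in> carrier ?F" "h (?p f) = h' (?p f)" "g \<in> carrier ?F" "h (?p g) = h' (?p g)"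
      using that by auto
    have "h (?p (f \<oplus>\<^bsub>?F\<^esub> g)) = h' (?p (f \<oplus>\<^bsub>?F\<^esub> g))"
      unfolding p(2)[OF f(1,3), symmetric]
      using ha[of h "?p f" "?p g"] ha[of h' "?p f" "?p g"] p(1)[OF f(1)] p(1)[OF f(3)] f(2,4) by simp
    then show ?thesis using F.add.m_closed[OF f(1,3)] by blast
  qed
  have sing: "single K x \<in> ?H" if "x \<in> carrier V \<times> carrier W" for x
    using that eq by (auto simp: pure_tensor_def single_closed[OF V.R.is_cring])
  have H: "submodule ?H K ?F"
  proof (rule F.submoduleI)
    show "\<ominus>\<^bsub>?F\<^esub> f \<in> ?H" if f: "f \<in> ?H" for f
    proof -
      have "(\<ominus>\<^bsub>K\<^esub> \<one>\<^bsub>K\<^esub>) \<odot>\<^bsub>?F\<^esub> f = \<ominus>\<^bsub>?F\<^esub> f" using f by (simp add: F.smult_l_minus)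
      then show ?thesis using sm[OF _ f, of "\<ominus>\<^bsub>K\<^esub> \<one>\<^bsub>K\<^esub>"] by (metis V.R.add.inv_closed V.R.one_closed)
    qed
    have W0: "zero W \<in> carrier W" using assms(2) by (simp add: module_def abelian_group_def abelian_monoid.zero_closed)
    then have x: "single K (\<zero>\<^bsub>V\<^esub>, zero W) \<in> ?H" by (intro sing) simp
    then have "\<zero>\<^bsub>K\<^esub> \<odot>\<^bsub>?F\<^esub> single K (\<zero>\<^bsub>V\<^esub>, zero W) = \<zero>\<^bsub>?F\<^esub>"
      by (intro F.smult_l_null) blast
    then show "\<zero>\<^bsub>?F\<^esub> \<in> ?H" using sm[OF V.R.zero_closed x] by metis
  qed (fact ad sm | blast)+
  have "h X = h' X" if X: "X \<in> carrier (tensor K V W)" for X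
  proof -
    obtain f where "f \<in> carrier ?F" "X = ?p f" using X by (auto simp: tensor_def quotient_simps rcosets_iff)
    then show ?thesis using free_induct[OF V.R.is_cring _ H sing] by blast
  qed
  then show ?thesis using h unfolding linear_maps_def by (auto intro: PiE_ext)
qed

lemma tensor_lift_exists:
  assumes V: "module K V" and W: "module K W" and U: "module K U"
    and b: "\<And>v w. v \<in> carrier V \<Longrightarrow> w \<in> carrier W \<Longrightarrow> \<beta> v w \<in> carrier U"
    and "\<And>v v' w. v \<in> carrier V \<Longrightarrow> v' \<in> carrier V \<Longrightarrow> w \<in> carrier W \<Longrightarrow> \<beta> (v \<oplus>\<^bsub>V\<^esub> v') w = \<beta> v w \<oplus>\<^bsub>U\<^esub> \<beta> v' w"
    and "\<And>v w w'. v \<in> carrier V \<Longrightarrow> w \<in> carrier W \<Longrightarrow> w' \<in> carrier W \<Longrightarrow> \<beta> v (w \<oplus>\<^bsub>W\<^esub> w') = \<beta> v w \<oplus>\<^bsub>U\<^esub> \<beta> v w'"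
    and "\<And>a v w. a \<in> carrier K \<Longrightarrow> v \<in> carrier V \<Longrightarrow> w \<in> carrier W \<Longrightarrow> \<beta> (a \<odot>\<^bsub>V\<^esub> v) w = a \<odot>\<^bsub>U\<^esub> \<beta> v w"
    and "\<And>a v w. a \<in> carrier K \<Longrightarrow> v \<in> carrier V \<Longrightarrow> w \<in> carrier W \<Longrightarrow> \<beta> v (a \<odot>\<^bsub>W\<^esub> w) = a \<odot>\<^bsub>U\<^esub> \<beta> v w"
  shows "tensor_lift K V W U \<beta> \<in> linear_maps K (tensor K V W) U \<and>
    (\<forall>v\<in>carrier V. \<forall>w\<in>carrier W. tensor_lift K V W U \<beta> (pure_tensor K V W v w) = \<beta> v w)"
proof -
  interpret V: module K V by fact
  interpret W: module K W by fact
  interpret U: module K U by fact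
  let ?X = "carrier V \<times> carrier W"
  let ?F = "free_module K ?X"
  let ?N = "tensor_subspace K V W"
  let ?p = "\<lambda>f. ?N +>\<^bsub>?F\<^esub> f"
  note s = tensor_sub[OF assms(1,2)]
  interpret F: module K ?F by (rule free_module_module[OF V.R.is_cring])
  interpret N: abelian_subgroup ?N ?F by (rule submodule_abelian_subgroup[OF F.module_axioms s(2)])
  note p = quotient_proj[OF F.module_axioms s(2), folded tensor_def]
  obtain \<Phi> where ph: "\<Phi> \<in> carrier ?F \<rightarrow> carrier U"
    and pa: "\<And>f g. f \<in> carrier ?F \<Longrightarrow> g \<in> carrier ?F \<Longrightarrow> \<Phi> (f \<oplus>\<^bsub>?F\<^esub> g) = \<Phi> f \<oplus>\<^bsub>U\<^esub> \<Phi> g"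
    and ps: "\<And>a f. a \<in> carrier K \<Longrightarrow> f \<in> carrier ?F \<Longrightarrow> \<Phi> (a \<odot>\<^bsub>?F\<^esub> f) = a \<odot>\<^bsub>U\<^esub> \<Phi> f"
    and pb: "\<And>x. x \<in> ?X \<Longrightarrow> \<Phi> (single K x) = (\<lambda>(v,w). \<beta> v w) x"
  proof (rule free_lift[OF V.R.is_cring U, of "\<lambda>(v,w). \<beta> v w" ?X])
    show "(\<lambda>(v,w). \<beta> v w) \<in> ?X \<rightarrow> carrier U" using b by auto
  qed (rule that; assumption)
  note sc[simp] = single_closed[OF V.R.is_cring, of _ ?X]
  have ph': "\<And>f. f \<in> carrier ?F \<Longrightarrow> \<Phi> f \<in> carrier U" using ph by auto
  have mm: "\<ominus>\<^bsub>?F\<^esub> a = (\<ominus>\<^bsub>K\<^esub> \<one>\<^bsub>K\<^esub>) \<odot>\<^bsub>?F\<^esub> a" if "a \<in> carrier ?F" for a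
    using that by (simp add: F.smult_l_minus)
  have pn: "\<Phi> (\<ominus>\<^bsub>?F\<^esub> f) = \<ominus>\<^bsub>U\<^esub> \<Phi> f" if "f \<in> carrier ?F" for f
    using that ps[of "\<ominus>\<^bsub>K\<^esub> \<one>\<^bsub>K\<^esub>" f] ph' by (simp add: mm U.smult_l_minus)
  have pm: "\<Phi> (f \<ominus>\<^bsub>?F\<^esub> g) = \<Phi> f \<ominus>\<^bsub>U\<^esub> \<Phi> g" if "f \<in> carrier ?F" "g \<in> carrier ?F" for f g
    using that by (simp add: a_minus_def pa pn)
  let ?Z = "{f \<in> carrier ?F. \<Phi> f = \<zero>\<^bsub>U\<^esub>}"
  have z0: "\<Phi> \<zero>\<^bsub>?F\<^esub> = \<zero>\<^bsub>U\<^esub>" using ps[of "\<zero>\<^bsub>K\<^esub>" "\<zero>\<^bsub>?F\<^esub>"] ph' F.smult_l_null[of "\<zero>\<^bsub>?F\<^esub>"] by simp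
  have Z: "submodule ?Z K ?F"
    by (rule F.submoduleI) (use z0 pn pa ps in auto)
  have "tensor_relations K V W \<subseteq> ?Z"
    unfolding tensor_relations_def Let_def
    using assms(4-) by (auto simp: pm pa ps pb U.r_neg a_minus_def[of U] intro!: F.minus_closed)
  then have NZ: "?N \<subseteq> ?Z" unfolding tensor_subspace_def span_of_def using Z by auto
  define h where "h = (\<lambda>X\<in>carrier (tensor K V W). \<Phi> (SOME f. f \<in> X))"
  have hp: "h (?p f) = \<Phi> f" if f: "f \<in> carrier ?F" for f
  proof -
    let ?g = "SOME g. g \<in> ?p f"
    have g: "?g \<in> ?p f" using N.a_rcos_self[OF f] by (rule someI[of "\<lambda>g. g \<in> ?p f"])
    then have gc: "?g \<in> carrier ?F" using N.a_elemrcos_carrier f by blast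
    have "?g \<oplus>\<^bsub>?F\<^esub> \<ominus>\<^bsub>?F\<^esub> f \<in> ?Z" using N.a_rcos_module_imp[OF f g] NZ by blast
    then have "\<Phi> ?g \<ominus>\<^bsub>U\<^esub> \<Phi> f = \<zero>\<^bsub>U\<^esub>" using f gc by (simp add: pa pn a_minus_def)
    then have "\<Phi> ?g = \<Phi> f" using ph' f gc by (metis U.add.inv_closed U.minus_minus U.minus_equality a_minus_def)
    then show ?thesis using p(1)[OF f] by (simp add: h_def)
  qed
  have cs: "\<exists>f\<in>carrier ?F. X = ?p f" if "X \<in> carrier (tensor K V W)" for X
    using that by (auto simp: tensor_def quotient_simps rcosets_iff)
  have hlin: "h \<in> linear_maps K (tensor K V W) U"
    unfolding linear_maps_def
  proof (intro CollectI conjI ballI)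
    have "h X \<in> carrier U" if "X \<in> carrier (tensor K V W)" for X using cs[OF that] hp ph' by auto
    then show "h \<in> carrier (tensor K V W) \<rightarrow>\<^sub>E carrier U" by (auto simp: h_def)
    fix x y assume "x \<in> carrier (tensor K V W)" "y \<in> carrier (tensor K V W)"
    then show "h (x \<oplus>\<^bsub>tensor K V W\<^esub> y) = h x \<oplus>\<^bsub>U\<^esub> h y" using cs[of x] cs[of y] by (auto simp: p hp pa)
  next
    fix a x assume "a \<in> carrier K" "x \<in> carrier (tensor K V W)"
    then show "h (a \<odot>\<^bsub>tensor K V W\<^esub> x) = a \<odot>\<^bsub>U\<^esub> h x" using cs[of x] by (auto simp: p hp ps)
  qed
  have hb: "\<forall>v\<in>carrier V. \<forall>w\<in>carrier W. h (pure_tensor K V W v w) = \<beta> v w"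
    by (auto simp: pure_tensor_def hp pb)
  show ?thesis unfolding tensor_lift_def
    by (rule theI[of _ h]) (use hlin hb tensor_lift_unique[OF V W U] in \<open>auto\<close>)
qed


subsection \<open>Tensor products of maps and associativity\<close>

text \<open>\<open>f \<otimes> g : V \<otimes> W \<rightarrow> V' \<otimes> W'\<close>\<close>

definition tensor_map ::
  "('k, 'r) ring_scheme \<Rightarrow> ('k, 'v) module \<Rightarrow> ('k, 'w) module \<Rightarrow>
   ('k, 'v2) module \<Rightarrow> ('k, 'w2) module \<Rightarrow>
   ('v \<Rightarrow> 'v2) \<Rightarrow> ('w \<Rightarrow> 'w2) \<Rightarrow> ('k, 'v, 'w) tens \<Rightarrow> ('k, 'v2, 'w2) tens"
  where "tensor_map K V W V' W' f g =
    tensor_lift K V W (tensor K V' W') (\<lambda>v w. pure_tensor K V' W' (f v) (g w))"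

text \<open>\<open>(U \<otimes> V) \<otimes> W \<rightarrow> U \<otimes> (V \<otimes> W)\<close> and its inverse\<close>

definition tensor_assoc ::
  "('k, 'r) ring_scheme \<Rightarrow> ('k, 'u) module \<Rightarrow> ('k, 'v) module \<Rightarrow> ('k, 'w) module \<Rightarrow>
   ('k, ('k, 'u, 'v) tens, 'w) tens \<Rightarrow> ('k, 'u, ('k, 'v, 'w) tens) tens"
  where "tensor_assoc K U V W =
    tensor_lift K (tensor K U V) W (tensor K U (tensor K V W))
      (\<lambda>t w. tensor_lift K U V (tensor K U (tensor K V W))
         (\<lambda>u v. pure_tensor K U (tensor K V W) u (pure_tensor K V W v w)) t)"

definition tensor_assoc_inv ::
  "('k, 'r) ring_scheme \<Rightarrow> ('k, 'u) module \<Rightarrow> ('k, 'v) module \<Rightarrow> ('k, 'w) module \<Rightarrow>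
   ('k, 'u, ('k, 'v, 'w) tens) tens \<Rightarrow> ('k, ('k, 'u, 'v) tens, 'w) tens"
  where "tensor_assoc_inv K U V W =
    tensor_lift K U (tensor K V W) (tensor K (tensor K U V) W)
      (\<lambda>u t. tensor_lift K V W (tensor K (tensor K U V) W)
         (\<lambda>v w. pure_tensor K (tensor K U V) W (pure_tensor K U V u v) w) t)"


section \<open>Braided vector spaces and braided bialgebras\<close>

text \<open>\<open>c \<otimes> V\<close> and \<open>V \<otimes> c\<close> as endomorphisms of \<open>(V \<otimes> V) \<otimes> V\<close>\<close>

definition braid12 ::
  "('k, 'r) ring_scheme \<Rightarrow> ('k, 'v) module \<Rightarrow> (('k, 'v, 'v) tens \<Rightarrow> ('k, 'v, 'v) tens) \<Rightarrow>
   ('k, ('k, 'v, 'v) tens, 'v) tens \<Rightarrow> ('k, ('k, 'v, 'v) tens, 'v) tens"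
  where "braid12 K V c = tensor_map K (tensor K V V) V (tensor K V V) V c (\<lambda>v. v)"

definition braid23 ::
  "('k, 'r) ring_scheme \<Rightarrow> ('k, 'v) module \<Rightarrow> (('k, 'v, 'v) tens \<Rightarrow> ('k, 'v, 'v) tens) \<Rightarrow>
   ('k, ('k, 'v, 'v) tens, 'v) tens \<Rightarrow> ('k, ('k, 'v, 'v) tens, 'v) tens"
  where "braid23 K V c t = tensor_assoc_inv K V V V
     (tensor_map K V (tensor K V V) V (tensor K V V) (\<lambda>v. v) c (tensor_assoc K V V V t))"

definition braided_vector_space ::
  "('k, 'r) ring_scheme \<Rightarrow> ('k, 'v) module \<Rightarrow> (('k, 'v, 'v) tens \<Rightarrow> ('k, 'v, 'v) tens) \<Rightarrow> bool"
  where "braided_vector_space K V c \<longleftrightarrow> field K \<and> module K V \<and>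
     is_linear K (tensor K V V) (tensor K V V) c \<and>
     (\<forall>t\<in>carrier (tensor K (tensor K V V) V).
        braid12 K V c (braid23 K V c (braid12 K V c t)) =
        braid23 K V c (braid12 K V c (braid23 K V c t)))"

definition unital_algebra :: "('k, 'r) ring_scheme \<Rightarrow> ('k, 'b) module \<Rightarrow> bool"
  where "unital_algebra K B \<longleftrightarrow> module K B \<and> ring B \<and>
     (\<forall>a\<in>carrier K. \<forall>x\<in>carrier B. \<forall>y\<in>carrier B.
        a \<odot>\<^bsub>B\<^esub> (x \<otimes>\<^bsub>B\<^esub> y) = (a \<odot>\<^bsub>B\<^esub> x) \<otimes>\<^bsub>B\<^esub> y \<and>
        a \<odot>\<^bsub>B\<^esub> (x \<otimes>\<^bsub>B\<^esub> y) = x \<otimes>\<^bsub>B\<^esub> (a \<odot>\<^bsub>B\<^esub> y))"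

text \<open>\<open>m : B \<otimes> B \<rightarrow> B\<close>\<close>

definition mult_map ::
  "('k, 'r) ring_scheme \<Rightarrow> ('k, 'b) module \<Rightarrow> ('k, 'b, 'b) tens \<Rightarrow> 'b"
  where "mult_map K B = tensor_lift K B B B (\<lambda>x y. x \<otimes>\<^bsub>B\<^esub> y)"

text \<open>\<open>\<epsilon> \<otimes> B\<close> and \<open>B \<otimes> \<epsilon>\<close>, composed with \<open>K \<otimes> B \<cong> B\<close> and \<open>B \<otimes> K \<cong> B\<close>\<close>

definition counit_left ::
  "('k, 'r) ring_scheme \<Rightarrow> ('k, 'b) module \<Rightarrow> ('b \<Rightarrow> 'k) \<Rightarrow> ('k, 'b, 'b) tens \<Rightarrow> 'b"
  where "counit_left K B \<epsilon> = tensor_lift K B B B (\<lambda>x y. \<epsilon> x \<odot>\<^bsub>B\<^esub> y)"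

definition counit_right ::
  "('k, 'r) ring_scheme \<Rightarrow> ('k, 'b) module \<Rightarrow> ('b \<Rightarrow> 'k) \<Rightarrow> ('k, 'b, 'b) tens \<Rightarrow> 'b"
  where "counit_right K B \<epsilon> = tensor_lift K B B B (\<lambda>x y. \<epsilon> y \<odot>\<^bsub>B\<^esub> x)"

text \<open>\<open>\<Delta> \<otimes> B\<close> and \<open>B \<otimes> \<Delta>\<close>, both with values in \<open>(B \<otimes> B) \<otimes> B\<close>\<close>

definition comult_left ::
  "('k, 'r) ring_scheme \<Rightarrow> ('k, 'b) module \<Rightarrow> ('b \<Rightarrow> ('k, 'b, 'b) tens) \<Rightarrow>
   ('k, 'b, 'b) tens \<Rightarrow> ('k, ('k, 'b, 'b) tens, 'b) tens"
  where "comult_left K B \<Delta> = tensor_map K B B (tensor K B B) B \<Delta> (\<lambda>x. x)"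

definition comult_right ::
  "('k, 'r) ring_scheme \<Rightarrow> ('k, 'b) module \<Rightarrow> ('b \<Rightarrow> ('k, 'b, 'b) tens) \<Rightarrow>
   ('k, 'b, 'b) tens \<Rightarrow> ('k, ('k, 'b, 'b) tens, 'b) tens"
  where "comult_right K B \<Delta> t =
    tensor_assoc_inv K B B B (tensor_map K B B B (tensor K B B) (\<lambda>x. x) \<Delta> t)"

definition coalgebra ::
  "('k, 'r) ring_scheme \<Rightarrow> ('k, 'b) module \<Rightarrow> ('b \<Rightarrow> ('k, 'b, 'b) tens) \<Rightarrow> ('b \<Rightarrow> 'k) \<Rightarrow> bool"
  where "coalgebra K B \<Delta> \<epsilon> \<longleftrightarrow> module K B \<and>
     is_linear K B (tensor K B B) \<Delta> \<and> is_linear K B (regular_module K) \<epsilon> \<and>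
     (\<forall>x\<in>carrier B. comult_left K B \<Delta> (\<Delta> x) = comult_right K B \<Delta> (\<Delta> x)) \<and>
     (\<forall>x\<in>carrier B. counit_left K B \<epsilon> (\<Delta> x) = x \<and> counit_right K B \<epsilon> (\<Delta> x) = x)"

text \<open>\<open>m \<otimes> B\<close> and \<open>B \<otimes> m\<close>, both on \<open>(B \<otimes> B) \<otimes> B\<close>\<close>

definition mult_left ::
  "('k, 'r) ring_scheme \<Rightarrow> ('k, 'b) module \<Rightarrow> ('k, ('k, 'b, 'b) tens, 'b) tens \<Rightarrow> ('k, 'b, 'b) tens"
  where "mult_left K B = tensor_map K (tensor K B B) B B B (mult_map K B) (\<lambda>x. x)"

definition mult_right ::
  "('k, 'r) ring_scheme \<Rightarrow> ('k, 'b) module \<Rightarrow> ('k, ('k, 'b, 'b) tens, 'b) tens \<Rightarrow> ('k, 'b, 'b) tens"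
  where "mult_right K B t =
    tensor_map K B (tensor K B B) B B (\<lambda>x. x) (mult_map K B) (tensor_assoc K B B B t)"

text \<open>\<open>B \<otimes> c \<otimes> B\<close> as an endomorphism of \<open>(B \<otimes> B) \<otimes> (B \<otimes> B)\<close>\<close>

definition braid_middle ::
  "('k, 'r) ring_scheme \<Rightarrow> ('k, 'b) module \<Rightarrow> (('k, 'b, 'b) tens \<Rightarrow> ('k, 'b, 'b) tens) \<Rightarrow>
   ('k, ('k, 'b, 'b) tens, ('k, 'b, 'b) tens) tens \<Rightarrow>
   ('k, ('k, 'b, 'b) tens, ('k, 'b, 'b) tens) tens"
  where "braid_middle K B c t =
    tensor_assoc_inv K B B (tensor K B B)
      (tensor_map K B (tensor K B (tensor K B B)) B (tensor K B (tensor K B B)) (\<lambda>x. x)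
         (\<lambda>s. tensor_assoc K B B B (braid12 K B c (tensor_assoc_inv K B B B s)))
         (tensor_assoc K B B (tensor K B B) t))"

text \<open>The unit of \<open>B\<close> enters only through \<open>\<one>\<^bsub>B\<^esub>\<close>; e.g.\ \<open>c (u \<otimes> B) = B \<otimes> u\<close> reads \<open>c (1 \<otimes> x) = x \<otimes> 1\<close>.\<close>

definition braided_bialgebra ::
  "('k, 'r) ring_scheme \<Rightarrow> ('k, 'b) module \<Rightarrow> ('b \<Rightarrow> ('k, 'b, 'b) tens) \<Rightarrow> ('b \<Rightarrow> 'k) \<Rightarrow>
   (('k, 'b, 'b) tens \<Rightarrow> ('k, 'b, 'b) tens) \<Rightarrow> bool"
  where "braided_bialgebra K B \<Delta> \<epsilon> c \<longleftrightarrow>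
     unital_algebra K B \<and> coalgebra K B \<Delta> \<epsilon> \<and> braided_vector_space K B c \<and>
     \<comment> \<open>\<open>c\<close> commutes with \<open>m\<close>\<close>
     (\<forall>t\<in>carrier (tensor K (tensor K B B) B).
        c (mult_left K B t) = mult_right K B (braid12 K B c (braid23 K B c t)) \<and>
        c (mult_right K B t) = mult_left K B (braid23 K B c (braid12 K B c t))) \<and>
     \<comment> \<open>\<open>c\<close> commutes with \<open>u\<close>\<close>
     (\<forall>x\<in>carrier B.
        c (pure_tensor K B B \<one>\<^bsub>B\<^esub> x) = pure_tensor K B B x \<one>\<^bsub>B\<^esub> \<and>
        c (pure_tensor K B B x \<one>\<^bsub>B\<^esub>) = pure_tensor K B B \<one>\<^bsub>B\<^esub> x) \<and>
     \<comment> \<open>\<open>c\<close> commutes with \<open>\<Delta>\<close>\<close>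
     (\<forall>t\<in>carrier (tensor K B B).
        comult_right K B \<Delta> (c t) = braid12 K B c (braid23 K B c (comult_left K B \<Delta> t)) \<and>
        comult_left K B \<Delta> (c t) = braid23 K B c (braid12 K B c (comult_right K B \<Delta> t))) \<and>
     \<comment> \<open>\<open>c\<close> commutes with \<open>\<epsilon>\<close>\<close>
     (\<forall>t\<in>carrier (tensor K B B).
        counit_left K B \<epsilon> (c t) = counit_right K B \<epsilon> t \<and>
        counit_right K B \<epsilon> (c t) = counit_left K B \<epsilon> t) \<and>
     \<comment> \<open>\<open>\<Delta> m = (m \<otimes> m) (B \<otimes> c \<otimes> B) (\<Delta> \<otimes> \<Delta>)\<close>\<close>
     (\<forall>t\<in>carrier (tensor K B B).
        \<Delta> (mult_map K B t) =
        tensor_map K (tensor K B B) (tensor K B B) B B (mult_map K B) (mult_map K B)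
          (braid_middle K B c
            (tensor_map K B B (tensor K B B) (tensor K B B) \<Delta> \<Delta> t))) \<and>
     \<Delta> \<one>\<^bsub>B\<^esub> = pure_tensor K B B \<one>\<^bsub>B\<^esub> \<one>\<^bsub>B\<^esub> \<and>
     \<epsilon> \<one>\<^bsub>B\<^esub> = \<one>\<^bsub>K\<^esub> \<and>
     (\<forall>x\<in>carrier B. \<forall>y\<in>carrier B. \<epsilon> (x \<otimes>\<^bsub>B\<^esub> y) = \<epsilon> x \<otimes>\<^bsub>K\<^esub> \<epsilon> y)"


section \<open>The tensor algebra\<close>

text \<open>Noncommutative polynomials: formal combinations of words, multiplied by concatenation.\<close>

definition free_algebra :: "('k, 'r) ring_scheme \<Rightarrow> 'x set \<Rightarrow> ('k, 'x list \<Rightarrow> 'k) module"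
  where "free_algebra K X = (free_module K (lists X))
    \<lparr>mult := (\<lambda>f g xs. \<Oplus>\<^bsub>K\<^esub>i\<in>{..length xs}. f (take i xs) \<otimes>\<^bsub>K\<^esub> g (drop i xs)),
     one := single K []\<rparr>"

definition tensor_algebra_ideal ::
  "('k, 'r) ring_scheme \<Rightarrow> ('k, 'v) module \<Rightarrow> ('v list \<Rightarrow> 'k) set"
  where "tensor_algebra_ideal K V = (let F = free_algebra K (carrier V) in
    Idl\<^bsub>F\<^esub> ({single K [v \<oplus>\<^bsub>V\<^esub> w] \<ominus>\<^bsub>F\<^esub> (single K [v] \<oplus>\<^bsub>F\<^esub> single K [w]) | v w.
              v \<in> carrier V \<and> w \<in> carrier V}
         \<union> {single K [a \<odot>\<^bsub>V\<^esub> v] \<ominus>\<^bsub>F\<^esub> a \<odot>\<^bsub>F\<^esub> single K [v] | a v.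
              a \<in> carrier K \<and> v \<in> carrier V}))"

definition tensor_algebra ::
  "('k, 'r) ring_scheme \<Rightarrow> ('k, 'v) module \<Rightarrow> ('k, ('v list \<Rightarrow> 'k) set) module"
  where "tensor_algebra K V = quotient (free_algebra K (carrier V)) (tensor_algebra_ideal K V)"

text \<open>The product \<open>v\<^sub>1 \<otimes> \<dots> \<otimes> v\<^sub>n\<close> in \<open>T(V)\<close>.\<close>

definition word ::
  "('k, 'r) ring_scheme \<Rightarrow> ('k, 'v) module \<Rightarrow> 'v list \<Rightarrow> ('v list \<Rightarrow> 'k) set"
  where "word K V vs =
    tensor_algebra_ideal K V +>\<^bsub>free_algebra K (carrier V)\<^esub> single K vs"

definition tensor_incl ::
  "('k, 'r) ring_scheme \<Rightarrow> ('k, 'v) module \<Rightarrow> 'v \<Rightarrow> ('v list \<Rightarrow> 'k) set"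
  where "tensor_incl K V v = word K V [v]"

text \<open>\<open>T\<^sup>n\<close> and the projection of \<open>T = \<Oplus>\<^sub>n T\<^sup>n\<close> onto it\<close>

definition tensor_power ::
  "('k, 'r) ring_scheme \<Rightarrow> ('k, 'v) module \<Rightarrow> nat \<Rightarrow> ('v list \<Rightarrow> 'k) set set"
  where "tensor_power K V n =
    span_of K (tensor_algebra K V) {word K V vs | vs. vs \<in> lists (carrier V) \<and> length vs = n}"

definition degree_proj ::
  "('k, 'r) ring_scheme \<Rightarrow> ('k, 'v) module \<Rightarrow> nat \<Rightarrow> ('v list \<Rightarrow> 'k) set \<Rightarrow> ('v list \<Rightarrow> 'k) set"
  where "degree_proj K V n = (THE p. p \<in> linear_maps K (tensor_algebra K V) (tensor_algebra K V) \<and>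
     (\<forall>vs\<in>lists (carrier V).
        p (word K V vs) = (if length vs = n then word K V vs else \<zero>\<^bsub>tensor_algebra K V\<^esub>)))"

text \<open>The braided bialgebra structures \<open>(\<Delta>, \<epsilon>, c\<^sub>T)\<close> on the algebra \<open>T(V)\<close> for which \<open>c\<^sub>T\<close> extends \<open>c\<close> and
  the elements of \<open>V\<close> are primitive. There is exactly one; its components are selected by \<open>THE\<close>,
  which is why the maps are required to be extensional.\<close>

definition is_tensor_bialgebra ::
  "('k, 'r) ring_scheme \<Rightarrow> ('k, 'v) module \<Rightarrow> (('k, 'v, 'v) tens \<Rightarrow> ('k, 'v, 'v) tens) \<Rightarrow>
   (('v list \<Rightarrow> 'k) set \<Rightarrow> ('k, ('v list \<Rightarrow> 'k) set, ('v list \<Rightarrow> 'k) set) tens) \<Rightarrow>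
   (('v list \<Rightarrow> 'k) set \<Rightarrow> 'k) \<Rightarrow>
   (('k, ('v list \<Rightarrow> 'k) set, ('v list \<Rightarrow> 'k) set) tens \<Rightarrow>
    ('k, ('v list \<Rightarrow> 'k) set, ('v list \<Rightarrow> 'k) set) tens) \<Rightarrow> bool"
  where "is_tensor_bialgebra K V c \<Delta> \<epsilon> d \<longleftrightarrow> (let T = tensor_algebra K V; \<iota> = tensor_incl K V in
     braided_bialgebra K T \<Delta> \<epsilon> d \<and>
     \<Delta> \<in> extensional (carrier T) \<and> \<epsilon> \<in> extensional (carrier T) \<and>
     d \<in> extensional (carrier (tensor K T T)) \<and>
     (\<forall>t\<in>carrier (tensor K V V).
        d (tensor_map K V V T T \<iota> \<iota> t) = tensor_map K V V T T \<iota> \<iota> (c t)) \<and>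
     (\<forall>v\<in>carrier V. \<Delta> (\<iota> v) =
        pure_tensor K T T (\<iota> v) \<one>\<^bsub>T\<^esub> \<oplus>\<^bsub>tensor K T T\<^esub> pure_tensor K T T \<one>\<^bsub>T\<^esub> (\<iota> v)))"

definition tensor_comult ::
  "('k, 'r) ring_scheme \<Rightarrow> ('k, 'v) module \<Rightarrow> (('k, 'v, 'v) tens \<Rightarrow> ('k, 'v, 'v) tens) \<Rightarrow>
   ('v list \<Rightarrow> 'k) set \<Rightarrow> ('k, ('v list \<Rightarrow> 'k) set, ('v list \<Rightarrow> 'k) set) tens"
  where "tensor_comult K V c = (THE \<Delta>. \<exists>\<epsilon> d. is_tensor_bialgebra K V c \<Delta> \<epsilon> d)"

definition tensor_braiding ::
  "('k, 'r) ring_scheme \<Rightarrow> ('k, 'v) module \<Rightarrow> (('k, 'v, 'v) tens \<Rightarrow> ('k, 'v, 'v) tens) \<Rightarrow>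
   ('k, ('v list \<Rightarrow> 'k) set, ('v list \<Rightarrow> 'k) set) tens \<Rightarrow>
   ('k, ('v list \<Rightarrow> 'k) set, ('v list \<Rightarrow> 'k) set) tens"
  where "tensor_braiding K V c = (THE d. \<exists>\<Delta> \<epsilon>. is_tensor_bialgebra K V c \<Delta> \<epsilon> d)"

text \<open>The component of \<open>\<Delta>\<^sub>T\<close> in \<open>T\<^sup>a \<otimes> T\<^sup>b\<close>, viewed inside \<open>T \<otimes> T\<close>.\<close>

definition comult_component ::
  "('k, 'r) ring_scheme \<Rightarrow> ('k, 'v) module \<Rightarrow> (('k, 'v, 'v) tens \<Rightarrow> ('k, 'v, 'v) tens) \<Rightarrow>
   nat \<Rightarrow> nat \<Rightarrow> ('v list \<Rightarrow> 'k) set \<Rightarrow> ('k, ('v list \<Rightarrow> 'k) set, ('v list \<Rightarrow> 'k) set) tens"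
  where "comult_component K V c a b x = (let T = tensor_algebra K V in
     tensor_map K T T T T (degree_proj K V a) (degree_proj K V b) (tensor_comult K V c x))"

definition prim_degree ::
  "('k, 'r) ring_scheme \<Rightarrow> ('k, 'v) module \<Rightarrow> (('k, 'v, 'v) tens \<Rightarrow> ('k, 'v, 'v) tens) \<Rightarrow>
   nat \<Rightarrow> ('v list \<Rightarrow> 'k) set set"
  where "prim_degree K V c n = {x \<in> tensor_power K V n. \<forall>a b. 1 \<le> a \<and> 1 \<le> b \<and> a + b = n \<longrightarrow>
     comult_component K V c a b x = \<zero>\<^bsub>tensor K (tensor_algebra K V) (tensor_algebra K V)\<^esub>}"

text \<open>\<open>E(V,c) = \<Oplus>\<^bsub>n \<ge> 2\<^esub> E\<^sub>n(V,c)\<close> as a vector space: the sum of the subspaces \<open>E\<^sub>n\<close> of the summands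
  \<open>T\<^sup>n\<close> of \<open>T\<close>.\<close>

definition prim ::
  "('k, 'r) ring_scheme \<Rightarrow> ('k, 'v) module \<Rightarrow> (('k, 'v, 'v) tens \<Rightarrow> ('k, 'v, 'v) tens) \<Rightarrow>
   ('k, ('v list \<Rightarrow> 'k) set) module"
  where "prim K V c = (let T = tensor_algebra K V in
     T\<lparr>carrier := span_of K T (\<Union>n\<in>{2..}. prim_degree K V c n)\<rparr>)"


section \<open>Braided Lie algebras\<close>

text \<open>The restrictions \<open>c\<^bsub>E,V\<^esub>\<close> and \<open>c\<^bsub>V,E\<^esub>\<close> of \<open>c\<^sub>T\<close>, as graphs: \<open>s = c\<^bsub>E,V\<^esub>(t)\<close> iff \<open>c\<^sub>T\<close> maps the image
  of \<open>t\<close> in \<open>T \<otimes> T\<close> to the image of \<open>s\<close>. Since \<open>c\<^sub>T\<close> does restrict and \<open>V \<otimes> E \<rightarrow> T \<otimes> T\<close> is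
  injective, these are graphs of total functions.\<close>

definition braiding_EV ::
  "('k, 'r) ring_scheme \<Rightarrow> ('k, 'v) module \<Rightarrow> (('k, 'v, 'v) tens \<Rightarrow> ('k, 'v, 'v) tens) \<Rightarrow>
   (('k, ('v list \<Rightarrow> 'k) set, 'v) tens \<times> ('k, 'v, ('v list \<Rightarrow> 'k) set) tens) set"
  where "braiding_EV K V c = (let T = tensor_algebra K V; E = prim K V c; \<iota> = tensor_incl K V in
     {(t, s). t \<in> carrier (tensor K E V) \<and> s \<in> carrier (tensor K V E) \<and>
        tensor_map K V E T T \<iota> (\<lambda>x. x) s =
        tensor_braiding K V c (tensor_map K E V T T (\<lambda>x. x) \<iota> t)})"

definition braiding_VE ::
  "('k, 'r) ring_scheme \<Rightarrow> ('k, 'v) module \<Rightarrow> (('k, 'v, 'v) tens \<Rightarrow> ('k, 'v, 'v) tens) \<Rightarrow>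
   (('k, 'v, ('v list \<Rightarrow> 'k) set) tens \<times> ('k, ('v list \<Rightarrow> 'k) set, 'v) tens) set"
  where "braiding_VE K V c = (let T = tensor_algebra K V; E = prim K V c; \<iota> = tensor_incl K V in
     {(t, s). t \<in> carrier (tensor K V E) \<and> s \<in> carrier (tensor K E V) \<and>
        tensor_map K E V T T (\<lambda>x. x) \<iota> s =
        tensor_braiding K V c (tensor_map K V E T T \<iota> (\<lambda>x. x) t)})"

definition braided_bracket ::
  "('k, 'r) ring_scheme \<Rightarrow> ('k, 'v) module \<Rightarrow> (('k, 'v, 'v) tens \<Rightarrow> ('k, 'v, 'v) tens) \<Rightarrow>
   (('v list \<Rightarrow> 'k) set \<Rightarrow> 'v) \<Rightarrow> bool"
  where "braided_bracket K V c b \<longleftrightarrow> (let E = prim K V c; id = (\<lambda>v. v) in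
     is_linear K E V b \<and>
     (\<forall>(t, s)\<in>braiding_EV K V c.
        c (tensor_map K E V V V b id t) = tensor_map K V E V V id b s) \<and>
     (\<forall>(t, s)\<in>braiding_VE K V c.
        c (tensor_map K V E V V id b t) = tensor_map K E V V V b id s))"

definition enveloping_ideal ::
  "('k, 'r) ring_scheme \<Rightarrow> ('k, 'v) module \<Rightarrow> (('k, 'v, 'v) tens \<Rightarrow> ('k, 'v, 'v) tens) \<Rightarrow>
   (('v list \<Rightarrow> 'k) set \<Rightarrow> 'v) \<Rightarrow> ('v list \<Rightarrow> 'k) set set"
  where "enveloping_ideal K V c b = (let T = tensor_algebra K V in
     Idl\<^bsub>T\<^esub> ((\<lambda>x. x \<ominus>\<^bsub>T\<^esub> tensor_incl K V (b x)) ` carrier (prim K V c)))"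

definition enveloping_algebra ::
  "('k, 'r) ring_scheme \<Rightarrow> ('k, 'v) module \<Rightarrow> (('k, 'v, 'v) tens \<Rightarrow> ('k, 'v, 'v) tens) \<Rightarrow>
   (('v list \<Rightarrow> 'k) set \<Rightarrow> 'v) \<Rightarrow> ('k, ('v list \<Rightarrow> 'k) set set) module"
  where "enveloping_algebra K V c b =
    quotient (tensor_algebra K V) (enveloping_ideal K V c b)"

definition enveloping_incl ::
  "('k, 'r) ring_scheme \<Rightarrow> ('k, 'v) module \<Rightarrow> (('k, 'v, 'v) tens \<Rightarrow> ('k, 'v, 'v) tens) \<Rightarrow>
   (('v list \<Rightarrow> 'k) set \<Rightarrow> 'v) \<Rightarrow> 'v \<Rightarrow> ('v list \<Rightarrow> 'k) set set"
  where "enveloping_incl K V c b v =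
    enveloping_ideal K V c b +>\<^bsub>tensor_algebra K V\<^esub> tensor_incl K V v"

definition braided_lie_algebra ::
  "('k, 'r) ring_scheme \<Rightarrow> ('k, 'v) module \<Rightarrow> (('k, 'v, 'v) tens \<Rightarrow> ('k, 'v, 'v) tens) \<Rightarrow>
   (('v list \<Rightarrow> 'k) set \<Rightarrow> 'v) \<Rightarrow> bool"
  where "braided_lie_algebra K V c b \<longleftrightarrow>
     braided_vector_space K V c \<and> braided_bracket K V c b \<and>
     inj_on (enveloping_incl K V c b) (carrier V)"

end

theory Submission
  imports Defs
begin

text \<open>Two things have to be shown about the zero map \<open>E(V,c) \<rightarrow> V\<close>. That it is a bracket
  (\<open>zero_braided_bracket\<close>) is immediate: both sides of each compatibility condition contain a tensor
  product of maps with a zero factor, which vanishes, and \<open>c\<close> is linear.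

  The injectivity of \<open>V \<rightarrow> U(V,c,0)\<close> is a matter of degrees. The defining ideal is generated by
  \<open>E(V,c)\<close>, which lives in degrees at least two, so it lies in the ideal \<open>\<Oplus>\<^bsub>n \<ge> 2\<^esub> T\<^sup>n\<close> and meets
  \<open>V = T\<^sup>1\<close> only in \<open>0\<close>.

  Instead of setting up the whole grading of \<open>T\<close>, the ideal of higher tensors is cut out by the terms of
  degree zero and one. A noncommutative polynomial \<open>f\<close> on the letters \<open>v \<in> V\<close> has a constant term \<open>f []\<close>
  and a linear part \<open>\<Sum>\<^sub>v f [v] v \<in> V\<close>. The pair of both is an algebra map to the square-zero extension
  \<open>K \<oplus> V\<close>: this is the product rule \<open>linear_part_mult\<close>, and it makes the set \<open>higher\<close> of polynomials
  where both vanish an ideal. This ideal contains the relations of \<open>T\<close> (\<open>tensor_ideal\<close>), hence its image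
  in \<open>T\<close> is an ideal that still detects membership of polynomials. The image contains \<open>E(V,c)\<close>
  (\<open>prim_higher\<close>) but no difference of distinct vectors (\<open>tensor_incl_diff\<close>).

  That \<open>T\<close> is a ring at all, so that ideals of \<open>T\<close> make sense, comes down to the associativity of the
  product of polynomials (\<open>conv_assoc\<close>).\<close>

section \<open>The free algebra\<close>

text \<open>The product of the free algebra, on arbitrary rather than finitely supported families of
  coefficients: then \<open>\<lambda>ys. f (x # ys)\<close> can be formed without regard to supports.\<close>

definition (in cring) conv :: "('x list \<Rightarrow> 'a) \<Rightarrow> ('x list \<Rightarrow> 'a) \<Rightarrow> 'x list \<Rightarrow> 'a"
  where "conv f g xs = (\<Oplus>i\<in>{..length xs}. f (take i xs) \<otimes> g (drop i xs))"

context cring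
begin

lemma conv_closed [simp]:
  assumes "\<And>xs. f xs \<in> carrier R" "\<And>xs. g xs \<in> carrier R"
  shows "conv f g xs \<in> carrier R"
  unfolding conv_def using assms by (auto intro!: finsum_closed)

lemma conv_Nil:
  assumes "\<And>xs. f xs \<in> carrier R" "\<And>xs. g xs \<in> carrier R"
  shows "conv f g [] = f [] \<otimes> g []"
  using assms by (simp add: conv_def)

text \<open>The cut before the first letter is separated from those behind it, and behind it only the
  coefficients \<open>\<lambda>ys. f (x # ys)\<close> of \<open>f\<close> matter.\<close>

lemma conv_Cons:
  assumes f: "\<And>xs. f xs \<in> carrier R" and g: "\<And>xs. g xs \<in> carrier R"
  shows "conv f g (x # xs) = f [] \<otimes> g (x # xs) \<oplus> conv (\<lambda>ys. f (x # ys)) g xs"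
proof -
  have "conv f g (x # xs) = (\<Oplus>i\<in>{..length xs}. f (x # take i xs) \<otimes> g (drop i xs)) \<oplus> f [] \<otimes> g (x # xs)"
    using finsum_Suc2[of "\<lambda>i. f (take i (x # xs)) \<otimes> g (drop i (x # xs))" "length xs"] f g
    by (simp add: conv_def del: finsum_Suc)
  then show ?thesis using f g by (simp add: conv_def a_comm)
qed

lemma conv_singleton:
  assumes "\<And>xs. f xs \<in> carrier R" "\<And>xs. g xs \<in> carrier R"
  shows "conv f g [x] = f [] \<otimes> g [x] \<oplus> f [x] \<otimes> g []"
  using assms by (simp add: conv_Cons conv_Nil)

lemma conv_add_left:
  assumes "\<And>xs. f xs \<in> carrier R" "\<And>xs. g xs \<in> carrier R" "\<And>xs. h xs \<in> carrier R"
  shows "conv (\<lambda>ys. f ys \<oplus> g ys) h xs = conv f h xs \<oplus> conv g h xs"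
  unfolding conv_def using assms by (simp add: l_distr finsum_addf Pi_def)

lemma conv_add_right:
  assumes "\<And>xs. f xs \<in> carrier R" "\<And>xs. g xs \<in> carrier R" "\<And>xs. h xs \<in> carrier R"
  shows "conv h (\<lambda>ys. f ys \<oplus> g ys) xs = conv h f xs \<oplus> conv h g xs"
  unfolding conv_def using assms by (simp add: r_distr finsum_addf Pi_def)

lemma conv_smult_left:
  assumes "\<And>xs. f xs \<in> carrier R" "\<And>xs. g xs \<in> carrier R" "a \<in> carrier R"
  shows "conv (\<lambda>ys. a \<otimes> f ys) g xs = a \<otimes> conv f g xs"
  unfolding conv_def using assms by (simp add: m_assoc finsum_rdistr Pi_def)

lemma conv_smult_right:
  assumes "\<And>xs. f xs \<in> carrier R" "\<And>xs. g xs \<in> carrier R" "a \<in> carrier R"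
  shows "conv f (\<lambda>ys. a \<otimes> g ys) xs = a \<otimes> conv f g xs"
  unfolding conv_def using assms by (simp add: m_lcomm finsum_rdistr Pi_def)

text \<open>Deleting a first letter acts on products by a rule of Leibniz type (\<open>conv_Cons\<close>), which allows an
  induction on the word with \<open>f\<close> varying. This avoids reindexing a double sum over pairs of cuts.\<close>

lemma conv_assoc:
  assumes "\<And>xs. f xs \<in> carrier R" "\<And>xs. g xs \<in> carrier R" "\<And>xs. h xs \<in> carrier R"
  shows "conv (conv f g) h xs = conv f (conv g h) xs"
  using assms
proof (induction xs arbitrary: f)
  case Nil
  then show ?case by (simp add: conv_Nil m_assoc)
next
  case (Cons x xs)
  let ?d = "\<lambda>k ys. k (x # ys)"
  have "conv (conv f g) h (x # xs) = f [] \<otimes> g [] \<otimes> h (x # xs) \<oplus>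
      conv (\<lambda>ys. f [] \<otimes> g (x # ys) \<oplus> conv (?d f) g ys) h xs"
    using Cons.prems by (simp add: conv_Nil conv_Cons[of "conv f g"] conv_Cons[of f g])
  also have "\<dots> = f [] \<otimes> g [] \<otimes> h (x # xs) \<oplus>
      (f [] \<otimes> conv (?d g) h xs \<oplus> conv (conv (?d f) g) h xs)"
    using Cons.prems by (simp add: conv_add_left conv_smult_left)
  also have "conv (conv (?d f) g) h xs = conv (?d f) (conv g h) xs"
    using Cons.prems by (intro Cons.IH) auto
  finally show ?case
    using Cons.prems by (simp add: conv_Cons r_distr m_assoc a_assoc)
qed

lemma conv_one:
  fixes f :: "'x list \<Rightarrow> 'a"
  assumes "\<And>xs. f xs \<in> carrier R"
  shows "conv (single R []) f xs = f xs" "conv f (single R []) xs = f xs"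
proof -
  have z: "conv (\<lambda>ys. \<zero>) f xs = \<zero>" for xs
    using assms by (simp add: conv_def finsum_zero)
  have c: "single R [] ys \<in> carrier R" for ys :: "'x list" by (simp add: single_def)
  have s: "single R [] [] = \<one>" "single R [] (x # xs) = \<zero>" for x :: 'x and xs
    by (simp_all add: single_def)
  show "conv (single R []) f xs = f xs"
    by (cases xs) (use assms z c in \<open>auto simp: conv_Nil conv_Cons s\<close>)
  show "conv f (single R []) xs = f xs"
    using assms
  proof (induction xs arbitrary: f)
    case (Cons x xs)
    show ?case
      using Cons.prems Cons.IH[of "\<lambda>ys. f (x # ys)"] c by (simp add: conv_Cons s)
  qed (simp add: conv_Nil c s)
qed

lemma conv_finite_support:
  assumes "\<And>xs. f xs \<in> carrier R" "\<And>xs. g xs \<in> carrier R"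
  shows "{xs. conv f g xs \<noteq> \<zero>} \<subseteq> (\<lambda>(a, b). a @ b) ` ({xs. f xs \<noteq> \<zero>} \<times> {xs. g xs \<noteq> \<zero>})"
proof
  fix xs assume "xs \<in> {xs. conv f g xs \<noteq> \<zero>}"
  then have "conv f g xs \<noteq> \<zero>" by simp
  then obtain i where "f (take i xs) \<otimes> g (drop i xs) \<noteq> \<zero>"
    unfolding conv_def by (metis (no_types, lifting) add.finprod_one_eqI)
  then have "f (take i xs) \<noteq> \<zero>" "g (drop i xs) \<noteq> \<zero>" using assms by auto
  then show "xs \<in> (\<lambda>(a, b). a @ b) ` ({xs. f xs \<noteq> \<zero>} \<times> {xs. g xs \<noteq> \<zero>})"
    by (intro image_eqI[of _ _ "(take i xs, drop i xs)"]) auto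
qed

end

lemma free_algebra_simps:
  "carrier (free_algebra K X) = carrier (free_module K (lists X))"
  "zero (free_algebra K X) = (\<lambda>x. \<zero>\<^bsub>K\<^esub>)"
  "add (free_algebra K X) = (\<lambda>f g x. f x \<oplus>\<^bsub>K\<^esub> g x)"
  "smult (free_algebra K X) = (\<lambda>a f x. a \<otimes>\<^bsub>K\<^esub> f x)"
  "one (free_algebra K X) = single K []"
  by (simp_all add: free_algebra_def free_module_def)

lemma (in cring) free_algebra_mult: "monoid.mult (free_algebra R X) = conv"
  by (simp add: free_algebra_def conv_def fun_eq_iff)

text \<open>The free algebra is the free module on words with another multiplication and unit in the record;
  this lets it inherit the module axioms.\<close>

lemma module_cong:
  assumes "module K M" "carrier M' = carrier M" "zero M' = zero M" "add M' = add M" "smult M' = smult M"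
  shows "module K M'"
proof -
  interpret module K M by fact
  have "abelian_group M'"
  proof (rule abelian_groupI)
    show "\<exists>y\<in>carrier M'. y \<oplus>\<^bsub>M'\<^esub> x = \<zero>\<^bsub>M'\<^esub>" if "x \<in> carrier M'" for x
      using that assms(2-) by (intro bexI[of _ "\<ominus>\<^bsub>M\<^esub> x"]) (simp_all add: M.l_neg)
  qed (use assms(2-) M.a_ac in auto)
  then show ?thesis
    by (intro moduleI R.is_cring)
      (use assms(2-) smult_closed smult_l_distr smult_r_distr smult_assoc1 in auto)
qed

lemma free_algebra_unital:
  assumes "cring K" shows "unital_algebra K (free_algebra K X)"
proof -
  interpret cring K by fact
  let ?F = "free_algebra K X"
  have m: "module K ?F"
    by (rule module_cong[OF free_module_module[OF assms, of "lists X"]])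
      (simp_all add: free_algebra_simps free_module_simps)
  interpret F: module K ?F by (rule m)
  have c: "\<And>xs. f xs \<in> carrier K" if "f \<in> carrier ?F" for f
    using that by (simp add: free_algebra_simps free_module_simps)
  have closed: "f \<otimes>\<^bsub>?F\<^esub> g \<in> carrier ?F" if f: "f \<in> carrier ?F" and g: "g \<in> carrier ?F" for f g
  proof -
    let ?A = "(\<lambda>(a, b). a @ b) ` ({xs. f xs \<noteq> \<zero>\<^bsub>K\<^esub>} \<times> {xs. g xs \<noteq> \<zero>\<^bsub>K\<^esub>})"
    have app: "a @ b \<in> lists X" if "f a \<noteq> \<zero>\<^bsub>K\<^esub>" "g b \<noteq> \<zero>\<^bsub>K\<^esub>" for a b
    proof -
      have "a \<in> lists X" "b \<in> lists X" using f g that unfolding free_algebra_simps free_module_simps by blast+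
      then show ?thesis by (simp only: append_in_lists_conv)
    qed
    have "?A \<subseteq> lists X"
    proof (rule image_subsetI)
      fix p assume "p \<in> {xs. f xs \<noteq> \<zero>\<^bsub>K\<^esub>} \<times> {xs. g xs \<noteq> \<zero>\<^bsub>K\<^esub>}"
      then obtain a b where p: "p = (a, b)" "f a \<noteq> \<zero>\<^bsub>K\<^esub>" "g b \<noteq> \<zero>\<^bsub>K\<^esub>" by blast
      then show "(case p of (a, b) \<Rightarrow> a @ b) \<in> lists X"
        using app[OF p(2,3)] by (simp only: p(1) prod.case)
    qed
    moreover have "{xs. conv f g xs \<noteq> \<zero>\<^bsub>K\<^esub>} \<subseteq> ?A" by (rule conv_finite_support[OF c[OF f] c[OF g]])
    moreover have "finite ?A"
      using f g by (intro finite_imageI finite_cartesian_product) (simp_all add: free_algebra_simps free_module_simps)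
    ultimately have fin: "finite {xs. conv f g xs \<noteq> \<zero>\<^bsub>K\<^esub>}" and "{xs. conv f g xs \<noteq> \<zero>\<^bsub>K\<^esub>} \<subseteq> lists X"
      by (meson finite_subset order_trans)+
    then have "conv f g xs = \<zero>\<^bsub>K\<^esub>" if "xs \<notin> lists X" for xs using that by blast
    then show ?thesis
      using c[OF f] c[OF g] fin by (simp add: free_algebra_simps free_module_simps free_algebra_mult)
  qed
  have "ring ?F"
  proof (rule ringI)
    show "abelian_group ?F" by (rule F.abelian_group_axioms)
    show "monoid ?F"
    proof (rule monoidI)
      show "\<one>\<^bsub>?F\<^esub> \<in> carrier ?F" using single_closed[OF assms, of "[]" "lists X"] by (simp add: free_algebra_simps)
    qed (use closed c in \<open>auto simp: free_algebra_mult free_algebra_simps(5) fun_eq_iff conv_assoc conv_one\<close>)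
  qed (use c in \<open>auto simp: free_algebra_mult free_algebra_simps(3) fun_eq_iff conv_add_left conv_add_right\<close>)
  then show ?thesis
    unfolding unital_algebra_def
    using m c by (auto simp: free_algebra_mult free_algebra_simps(4) fun_eq_iff conv_smult_left conv_smult_right)
qed


section \<open>Ideals and quotients of algebras\<close>

text \<open>Scalars act through multiples of the unit: \<open>a x = (a 1) x\<close>. Hence spans and generated ideals can be
  bounded by the same set.\<close>

lemma ideal_submodule:
  assumes A: "unital_algebra K A" and I: "ideal I A"
  shows "submodule I K A"
proof -
  interpret module K A using A by (simp add: unital_algebra_def)
  interpret A: ring A using A by (simp add: unital_algebra_def)
  interpret I: ideal I A by fact
  have "a \<odot>\<^bsub>A\<^esub> x \<in> I" if "a \<in> carrier K" "x \<in> I" for a x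
  proof -
    have x: "x \<in> carrier A" using that(2) by (rule I.Icarr)
    have "a \<odot>\<^bsub>A\<^esub> x = (a \<odot>\<^bsub>A\<^esub> \<one>\<^bsub>A\<^esub>) \<otimes>\<^bsub>A\<^esub> x"
      using A that(1) x A.one_closed A.l_one[OF x] unfolding unital_algebra_def by metis
    then show ?thesis using I.I_l_closed[OF that(2), of "a \<odot>\<^bsub>A\<^esub> \<one>\<^bsub>A\<^esub>"] that(1) by simp
  qed
  then show ?thesis by (intro submoduleI) (auto intro: I.Icarr I.a_inv_closed)
qed

lemma quotient_mult:
  assumes "ideal I A" "x \<in> carrier A" "y \<in> carrier A"
  shows "(I +>\<^bsub>A\<^esub> x) \<otimes>\<^bsub>quotient A I\<^esub> (I +>\<^bsub>A\<^esub> y) = I +>\<^bsub>A\<^esub> (x \<otimes>\<^bsub>A\<^esub> y)"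
  using ideal.rcoset_mult_add[OF assms] by (simp add: quotient_simps)

lemma quotient_unital:
  fixes A :: "('k, 'a) module"
  assumes A: "unital_algebra K A" and I: "ideal I A"
  shows "unital_algebra K (quotient A I)"
proof -
  let ?Q = "quotient A I"
  have mA: "module K A" using A by (simp add: unital_algebra_def)
  interpret A: ring A using A by (simp add: unital_algebra_def)
  interpret AM: module K A by (rule mA)
  note sub = ideal_submodule[OF A I]
  note p = quotient_proj[OF mA sub] quotient_mult[OF I]
  interpret Q: module K ?Q by (rule quotient_module[OF mA sub])
  have cs: "\<exists>x\<in>carrier A. X = I +>\<^bsub>A\<^esub> x" if "X \<in> carrier ?Q" for X
    using that by (simp add: quotient_simps rcosets_iff)
  have one: "\<one>\<^bsub>?Q\<^esub> = I +>\<^bsub>A\<^esub> \<one>\<^bsub>A\<^esub>" by (simp add: quotient_simps)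
  have "ring ?Q"
  proof (rule ringI)
    show "abelian_group ?Q" by (rule Q.abelian_group_axioms)
    show "monoid ?Q"
      by (rule monoidI) (auto dest!: cs simp: p one A.m_assoc)
  qed (auto dest!: cs simp: p A.l_distr A.r_distr)
  moreover have "(a \<odot>\<^bsub>A\<^esub> x) \<otimes>\<^bsub>A\<^esub> y = a \<odot>\<^bsub>A\<^esub> (x \<otimes>\<^bsub>A\<^esub> y)" "x \<otimes>\<^bsub>A\<^esub> (a \<odot>\<^bsub>A\<^esub> y) = a \<odot>\<^bsub>A\<^esub> (x \<otimes>\<^bsub>A\<^esub> y)"
    if "a \<in> carrier K" "x \<in> carrier A" "y \<in> carrier A" for a x y
    using A that unfolding unital_algebra_def by metis+
  ultimately show ?thesis
    unfolding unital_algebra_def using Q.module_axioms by (auto dest!: cs simp: p)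
qed

lemma coset_eq_imp_diff:
  fixes A :: "('k, 'a) module"
  assumes A: "module K A" and I: "submodule I K A" and x: "x \<in> carrier A" and y: "y \<in> carrier A"
    and eq: "I +>\<^bsub>A\<^esub> x = I +>\<^bsub>A\<^esub> y"
  shows "x \<ominus>\<^bsub>A\<^esub> y \<in> I"
proof -
  interpret I: abelian_subgroup I A by (rule submodule_abelian_subgroup[OF A I])
  have "x \<in> I +>\<^bsub>A\<^esub> y" using I.a_rcos_self[OF x] eq by simp
  then show ?thesis using I.a_rcos_module_imp[OF y] by (simp add: a_minus_def)
qed

lemma coset_minus:
  fixes A :: "('k, 'a) module"
  assumes A: "module K A" and I: "submodule I K A" and x: "x \<in> carrier A" and y: "y \<in> carrier A"
  shows "(I +>\<^bsub>A\<^esub> x) \<ominus>\<^bsub>quotient A I\<^esub> (I +>\<^bsub>A\<^esub> y) = I +>\<^bsub>A\<^esub> (x \<ominus>\<^bsub>A\<^esub> y)"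
proof -
  interpret A: module K A by fact
  interpret Q: module K "quotient A I" by (rule quotient_module[OF A I])
  note p = quotient_proj[OF A I]
  have "(I +>\<^bsub>A\<^esub> x) = (I +>\<^bsub>A\<^esub> (x \<ominus>\<^bsub>A\<^esub> y)) \<oplus>\<^bsub>quotient A I\<^esub> (I +>\<^bsub>A\<^esub> y)"
    using x y by (simp add: p A.minus_eq A.a_assoc A.l_neg)
  then show ?thesis using x y p(1) by (simp add: Q.minus_eq Q.a_assoc Q.r_neg)
qed

lemma quotient_ideal:
  fixes A :: "('k, 'a) module"
  assumes A: "unital_algebra K A" and I: "ideal I A" and N: "ideal N A"
  shows "ideal ((\<lambda>x. I +>\<^bsub>A\<^esub> x) ` N) (quotient A I)"
proof -
  let ?Q = "quotient A I" and ?p = "\<lambda>x. I +>\<^bsub>A\<^esub> x"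
  have mA: "module K A" using A by (simp add: unital_algebra_def)
  interpret A: module K A by (rule mA)
  interpret N: ideal N A by (rule N)
  note sub = ideal_submodule[OF A I]
  note p = quotient_proj[OF mA sub] quotient_mult[OF I]
  interpret Q: module K ?Q by (rule quotient_module[OF mA sub])
  have Nc: "x \<in> carrier A" if "x \<in> N" for x using that by (rule N.Icarr)
  have cs: "\<exists>x\<in>carrier A. X = I +>\<^bsub>A\<^esub> x" if "X \<in> carrier ?Q" for X
    using that by (simp add: quotient_simps rcosets_iff)
  have "?p ` N \<subseteq> carrier ?Q" "?p ` N \<noteq> {}"
    using p(1) Nc additive_subgroup.zero_closed[OF N.additive_subgroup_axioms] by blast+
  moreover have "\<ominus>\<^bsub>?Q\<^esub> X \<in> ?p ` N" if "X \<in> ?p ` N" for X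
  proof -
    from that obtain x where x: "x \<in> N" "X = ?p x" by auto
    have "X \<oplus>\<^bsub>?Q\<^esub> ?p (\<ominus>\<^bsub>A\<^esub> x) = \<zero>\<^bsub>?Q\<^esub>"
      using x Nc[of x] p by (metis A.M.add.inv_closed A.M.r_neg A.smult_l_null A.M.zero_closed A.R.zero_closed Q.smult_l_null)
    then have "\<ominus>\<^bsub>?Q\<^esub> X = ?p (\<ominus>\<^bsub>A\<^esub> x)"
      using x Nc[of x] p(1) by (metis A.M.add.inv_closed Q.M.minus_equality Q.M.a_comm)
    then show ?thesis using x N.a_inv_closed by blast
  qed
  moreover have "X \<oplus>\<^bsub>?Q\<^esub> Y \<in> ?p ` N" if "X \<in> ?p ` N" "Y \<in> ?p ` N" for X Y
    using that Nc N.a_closed by (auto simp: p)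
  ultimately have "subgroup (?p ` N) (add_monoid ?Q)"
    by (intro Q.M.add.subgroupI) auto
  moreover have "ring ?Q" using quotient_unital[OF A I] by (simp add: unital_algebra_def)
  ultimately show ?thesis
    by (intro idealI) (use Nc N.I_l_closed N.I_r_closed in \<open>auto dest!: cs simp: p\<close>)
qed

text \<open>Because \<open>N\<close> contains \<open>I\<close>, it is a union of cosets of \<open>I\<close>, so membership in its image can be
  tested on any representative.\<close>

lemma quotient_ideal_iff:
  fixes A :: "('k, 'a) module"
  assumes A: "unital_algebra K A" and I: "ideal I A" and N: "ideal N A" and IN: "I \<subseteq> N"
    and x: "x \<in> carrier A"
  shows "I +>\<^bsub>A\<^esub> x \<in> (\<lambda>x. I +>\<^bsub>A\<^esub> x) ` N \<longleftrightarrow> x \<in> N"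
proof
  assume "I +>\<^bsub>A\<^esub> x \<in> (\<lambda>x. I +>\<^bsub>A\<^esub> x) ` N"
  then obtain y where y: "y \<in> N" "I +>\<^bsub>A\<^esub> x = I +>\<^bsub>A\<^esub> y" by auto
  interpret A: module K A using A by (simp add: unital_algebra_def)
  interpret N: ideal N A by (rule N)
  have yc: "y \<in> carrier A" using y(1) by (rule N.Icarr)
  have "x \<ominus>\<^bsub>A\<^esub> y \<in> N"
    using coset_eq_imp_diff[OF A.module_axioms ideal_submodule[OF A I] x yc y(2)] IN by auto
  then have "(x \<ominus>\<^bsub>A\<^esub> y) \<oplus>\<^bsub>A\<^esub> y \<in> N" using y(1) by (rule N.a_closed)
  then show "x \<in> N" using x yc by (simp add: A.minus_eq A.a_assoc A.l_neg)
qed auto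


section \<open>Elements of the tensor algebra without terms of degree zero and one\<close>

text \<open>\<open>ev\<close> is the canonical map from formal to actual linear combinations, \<open>f \<mapsto> \<Sum>\<^sub>v f v \<odot> v\<close>. It is
  described by its properties, since the universal property of the free module supplies it
  (\<open>evaluation_exists\<close>).\<close>

locale evaluation = module K V
  for K :: "('k, 'r) ring_scheme" and V :: "('k, 'v) module" +
  fixes ev :: "('v \<Rightarrow> 'k) \<Rightarrow> 'v"
  assumes ev_closed: "f \<in> carrier (free_module K (carrier V)) \<Longrightarrow> ev f \<in> carrier V"
    and ev_add: "f \<in> carrier (free_module K (carrier V)) \<Longrightarrow> g \<in> carrier (free_module K (carrier V)) \<Longrightarrow>
      ev (\<lambda>v. f v \<oplus>\<^bsub>K\<^esub> g v) = ev f \<oplus>\<^bsub>V\<^esub> ev g"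
    and ev_smult: "a \<in> carrier K \<Longrightarrow> f \<in> carrier (free_module K (carrier V)) \<Longrightarrow>
      ev (\<lambda>v. a \<otimes>\<^bsub>K\<^esub> f v) = a \<odot>\<^bsub>V\<^esub> ev f"
    and ev_single: "v \<in> carrier V \<Longrightarrow> ev (single K v) = v"
begin

abbreviation "F \<equiv> free_algebra K (carrier V)"
abbreviation "T \<equiv> tensor_algebra K V"

definition linear_part :: "('v list \<Rightarrow> 'k) \<Rightarrow> 'v"
  where "linear_part f = ev (\<lambda>v. f [v])"

text \<open>The preimage of \<open>\<Oplus>\<^bsub>n \<ge> 2\<^esub> T\<^sup>n\<close> under the projection to the tensor algebra. The linear part, and not
  every coefficient in degree one, has to vanish, because \<open>[v + w] - [v] - [w]\<close> represents \<open>0\<close>.\<close>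

definition higher :: "('v list \<Rightarrow> 'k) set"
  where "higher = {f \<in> carrier F. f [] = \<zero>\<^bsub>K\<^esub> \<and> linear_part f = \<zero>\<^bsub>V\<^esub>}"

lemma F_unital: "unital_algebra K F"
  by (rule free_algebra_unital[OF R.is_cring])

lemma F_module: "module K F" and F_ring: "ring F"
  using F_unital by (auto simp: unital_algebra_def)

lemma F_value: "f \<in> carrier F \<Longrightarrow> f xs \<in> carrier K"
  by (simp add: free_algebra_simps free_module_simps)

lemma single_F: "xs \<in> lists (carrier V) \<Longrightarrow> single K xs \<in> carrier F"
  using single_closed[OF R.is_cring] by (simp add: free_algebra_simps)

lemma degree_one_coeffs:
  assumes "f \<in> carrier F" shows "(\<lambda>v. f [v]) \<in> carrier (free_module K (carrier V))"
proof -
  have "finite {xs. f xs \<noteq> \<zero>\<^bsub>K\<^esub>}" using assms by (simp add: free_algebra_simps free_module_simps)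
  then have "finite ((\<lambda>v. [v]) -` {xs. f xs \<noteq> \<zero>\<^bsub>K\<^esub>})" by (rule finite_vimageI) (simp add: inj_on_def)
  then show ?thesis using assms by (auto simp: free_algebra_simps free_module_simps vimage_def)
qed

lemma linear_part_closed: "f \<in> carrier F \<Longrightarrow> linear_part f \<in> carrier V"
  by (simp add: linear_part_def ev_closed degree_one_coeffs)

lemma linear_part_add:
  "f \<in> carrier F \<Longrightarrow> g \<in> carrier F \<Longrightarrow> linear_part (f \<oplus>\<^bsub>F\<^esub> g) = linear_part f \<oplus>\<^bsub>V\<^esub> linear_part g"
  by (simp add: linear_part_def free_algebra_simps(3) ev_add degree_one_coeffs)

lemma linear_part_smult:
  "a \<in> carrier K \<Longrightarrow> f \<in> carrier F \<Longrightarrow> linear_part (a \<odot>\<^bsub>F\<^esub> f) = a \<odot>\<^bsub>V\<^esub> linear_part f"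
  by (simp add: linear_part_def free_algebra_simps(4) ev_smult degree_one_coeffs)

text \<open>A one-letter word has exactly two cuts, and each puts the letter on one side and the empty word on
  the other.\<close>

lemma linear_part_mult:
  assumes f: "f \<in> carrier F" and g: "g \<in> carrier F"
  shows "linear_part (f \<otimes>\<^bsub>F\<^esub> g) = f [] \<odot>\<^bsub>V\<^esub> linear_part g \<oplus>\<^bsub>V\<^esub> g [] \<odot>\<^bsub>V\<^esub> linear_part f"
proof -
  have "(\<lambda>v. (f \<otimes>\<^bsub>F\<^esub> g) [v]) = (\<lambda>v. (f [] \<odot>\<^bsub>F\<^esub> g \<oplus>\<^bsub>F\<^esub> g [] \<odot>\<^bsub>F\<^esub> f) [v])"
    using F_value[OF f] F_value[OF g]
    by (simp add: R.free_algebra_mult R.conv_singleton free_algebra_simps R.m_comm)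
  then have "linear_part (f \<otimes>\<^bsub>F\<^esub> g) = linear_part (f [] \<odot>\<^bsub>F\<^esub> g \<oplus>\<^bsub>F\<^esub> g [] \<odot>\<^bsub>F\<^esub> f)"
    by (simp add: linear_part_def)
  then show ?thesis
    using f g F_value by (simp add: linear_part_add linear_part_smult module.smult_closed[OF F_module])
qed

lemma linear_part_word:
  "v \<in> carrier V \<Longrightarrow> linear_part (single K [v]) = v"
  "length xs \<noteq> 1 \<Longrightarrow> linear_part (single K xs) = \<zero>\<^bsub>V\<^esub>"
proof -
  assume v: "v \<in> carrier V"
  have "(\<lambda>w. single K [v] [w]) = single K v" by (simp add: single_def fun_eq_iff)
  then show "linear_part (single K [v]) = v" using ev_single[OF v] by (simp add: linear_part_def)
next
  assume l: "length xs \<noteq> 1"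
  have z: "(\<lambda>v. \<zero>\<^bsub>K\<^esub>) \<in> carrier (free_module K (carrier V))" by (simp add: free_module_simps)
  have "(\<lambda>w. single K xs [w]) = (\<lambda>w. \<zero>\<^bsub>K\<^esub> \<otimes>\<^bsub>K\<^esub> \<zero>\<^bsub>K\<^esub>)" using l by (auto simp: single_def fun_eq_iff)
  then show "linear_part (single K xs) = \<zero>\<^bsub>V\<^esub>"
    using ev_smult[OF R.zero_closed z] ev_closed[OF z] by (simp add: linear_part_def)
qed

lemma F_uminus:
  assumes "f \<in> carrier F"
  shows "\<ominus>\<^bsub>F\<^esub> f = (\<ominus>\<^bsub>K\<^esub> \<one>\<^bsub>K\<^esub>) \<odot>\<^bsub>F\<^esub> f"
proof -
  interpret F: module K F by (rule F_module)
  show ?thesis using assms by (simp add: F.smult_l_minus)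
qed

lemma low_degree_minus:
  assumes f: "f \<in> carrier F" and g: "g \<in> carrier F"
  shows "linear_part (f \<ominus>\<^bsub>F\<^esub> g) = linear_part f \<ominus>\<^bsub>V\<^esub> linear_part g"
    and "(f \<ominus>\<^bsub>F\<^esub> g) xs = f xs \<ominus>\<^bsub>K\<^esub> g xs"
proof -
  interpret F: module K F by (rule F_module)
  have e: "f \<ominus>\<^bsub>F\<^esub> g = f \<oplus>\<^bsub>F\<^esub> (\<ominus>\<^bsub>K\<^esub> \<one>\<^bsub>K\<^esub>) \<odot>\<^bsub>F\<^esub> g" using F_uminus[OF g] by (simp add: F.minus_eq)
  show "linear_part (f \<ominus>\<^bsub>F\<^esub> g) = linear_part f \<ominus>\<^bsub>V\<^esub> linear_part g"
    using f g linear_part_closed[OF g] by (simp add: e linear_part_add linear_part_smult smult_l_minus M.minus_eq)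
  show "(f \<ominus>\<^bsub>F\<^esub> g) xs = f xs \<ominus>\<^bsub>K\<^esub> g xs"
    using F_value[OF g] by (simp add: e free_algebra_simps R.minus_eq R.l_minus)
qed

lemma higher_ideal: "ideal higher F"
proof -
  interpret F: module K F by (rule F_module)
  interpret F: ring F by (rule F_ring)
  have z: "linear_part \<zero>\<^bsub>F\<^esub> = \<zero>\<^bsub>V\<^esub>"
    using linear_part_smult[of "\<zero>\<^bsub>K\<^esub>" "\<zero>\<^bsub>F\<^esub>"] linear_part_closed[of "\<zero>\<^bsub>F\<^esub>"] by simp
  have "submodule higher K F"
  proof (rule F.submoduleI)
    show "\<zero>\<^bsub>F\<^esub> \<in> higher" using z F.zero_closed by (simp add: higher_def free_algebra_simps(2))
    show sm: "a \<odot>\<^bsub>F\<^esub> f \<in> higher" if "a \<in> carrier K" "f \<in> higher" for a f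
      using that F.smult_closed by (simp add: higher_def linear_part_smult) (simp add: free_algebra_simps(4))
    show "\<ominus>\<^bsub>F\<^esub> f \<in> higher" if "f \<in> higher" for f
      using that sm[of "\<ominus>\<^bsub>K\<^esub> \<one>\<^bsub>K\<^esub>" f] F_uminus[of f] by (simp add: higher_def)
    show "f \<oplus>\<^bsub>F\<^esub> g \<in> higher" if "f \<in> higher" "g \<in> higher" for f g
      using that F.add.m_closed by (simp add: higher_def linear_part_add) (simp add: free_algebra_simps(3))
  qed (auto simp: higher_def)
  then have "subgroup higher (add_monoid F)" by (rule submodule.axioms(1))
  moreover have "(f \<otimes>\<^bsub>F\<^esub> g) [] = f [] \<otimes>\<^bsub>K\<^esub> g []" if "f \<in> carrier F" "g \<in> carrier F" for f g
    using F_value[OF that(1)] F_value[OF that(2)] by (simp add: R.free_algebra_mult R.conv_Nil)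
  ultimately show ?thesis
    by (intro idealI F_ring)
      (auto simp: higher_def linear_part_mult F_value linear_part_closed)
qed

text \<open>The relations of the tensor algebra are the additivity and homogeneity of the letters, and \<open>ev\<close> is
  linear and takes each letter to the vector that it names.\<close>

lemma tensor_ideal:
  shows "ideal (tensor_algebra_ideal K V) F" and "tensor_algebra_ideal K V \<subseteq> higher"
proof -
  interpret F: module K F by (rule F_module)
  interpret F: ring F by (rule F_ring)
  let ?R = "{single K [v \<oplus>\<^bsub>V\<^esub> w] \<ominus>\<^bsub>F\<^esub> (single K [v] \<oplus>\<^bsub>F\<^esub> single K [w]) | v w. v \<in> carrier V \<and> w \<in> carrier V}
    \<union> {single K [a \<odot>\<^bsub>V\<^esub> v] \<ominus>\<^bsub>F\<^esub> a \<odot>\<^bsub>F\<^esub> single K [v] | a v. a \<in> carrier K \<and> v \<in> carrier V}"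
  have I: "tensor_algebra_ideal K V = Idl\<^bsub>F\<^esub> ?R" by (simp add: tensor_algebra_ideal_def Let_def)
  have e: "single K [v] [] = \<zero>\<^bsub>K\<^esub>" for v :: 'v by (simp add: single_def)
  have "single K [v \<oplus>\<^bsub>V\<^esub> w] \<ominus>\<^bsub>F\<^esub> (single K [v] \<oplus>\<^bsub>F\<^esub> single K [w]) \<in> higher"
    if "v \<in> carrier V" "w \<in> carrier V" for v w
  proof -
    have s: "single K [v \<oplus>\<^bsub>V\<^esub> w] \<in> carrier F" "single K [v] \<in> carrier F" "single K [w] \<in> carrier F"
      using that by (auto intro!: single_F)
    have "(single K [v] \<oplus>\<^bsub>F\<^esub> single K [w]) [] = \<zero>\<^bsub>K\<^esub>" by (simp add: free_algebra_simps(3) e)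
    then show ?thesis using s that
      by (simp add: higher_def low_degree_minus linear_part_add linear_part_word e M.minus_eq R.minus_eq M.r_neg)
  qed
  moreover have "single K [a \<odot>\<^bsub>V\<^esub> v] \<ominus>\<^bsub>F\<^esub> a \<odot>\<^bsub>F\<^esub> single K [v] \<in> higher"
    if "a \<in> carrier K" "v \<in> carrier V" for a v
  proof -
    have s: "single K [a \<odot>\<^bsub>V\<^esub> v] \<in> carrier F" "single K [v] \<in> carrier F"
      using that by (auto intro!: single_F)
    have "(a \<odot>\<^bsub>F\<^esub> single K [v]) [] = \<zero>\<^bsub>K\<^esub>" using that by (simp add: free_algebra_simps(4) e)
    then show ?thesis using s that
      by (simp add: higher_def low_degree_minus linear_part_smult linear_part_word e M.minus_eq R.minus_eq M.r_neg)
  qed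
  ultimately have R: "?R \<subseteq> higher" by blast
  then have "?R \<subseteq> carrier F" by (auto simp: higher_def)
  then show "ideal (tensor_algebra_ideal K V) F" unfolding I by (rule F.genideal_ideal)
  show "tensor_algebra_ideal K V \<subseteq> higher" unfolding I by (rule F.genideal_minimal[OF higher_ideal R])
qed

abbreviation higher_tensors :: "('v list \<Rightarrow> 'k) set set"
  where "higher_tensors \<equiv> (\<lambda>f. tensor_algebra_ideal K V +>\<^bsub>F\<^esub> f) ` higher"

lemma T_unital: "unital_algebra K T"
  unfolding tensor_algebra_def by (rule quotient_unital[OF F_unital tensor_ideal(1)])

lemma T_module: "module K T" and T_ring: "ring T"
  using T_unital by (auto simp: unital_algebra_def)

lemma higher_tensors_ideal: "ideal higher_tensors T"
  unfolding tensor_algebra_def by (rule quotient_ideal[OF F_unital tensor_ideal(1) higher_ideal])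

lemma word_closed: "xs \<in> lists (carrier V) \<Longrightarrow> word K V xs \<in> carrier T"
  unfolding word_def tensor_algebra_def
  by (rule quotient_proj(1)[OF F_module ideal_submodule[OF F_unital tensor_ideal(1)] single_F])

lemma tensor_incl_closed: "v \<in> carrier V \<Longrightarrow> tensor_incl K V v \<in> carrier T"
  by (simp add: tensor_incl_def word_closed)

text \<open>The generators of the enveloping ideal are \<open>x - \<iota> 0\<close>. For them to lie among the higher
  tensors, \<open>\<iota> 0\<close> has to, as \<open>E(V,c)\<close> does by \<open>prim_higher\<close>.\<close>

lemma tensor_incl_zero: "tensor_incl K V \<zero>\<^bsub>V\<^esub> \<in> higher_tensors"
proof -
  have "single K [\<zero>\<^bsub>V\<^esub>] \<in> higher"
    using single_F[of "[\<zero>\<^bsub>V\<^esub>]"] by (simp add: higher_def linear_part_word) (simp add: single_def)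
  then show ?thesis by (simp add: tensor_incl_def word_def)
qed

text \<open>The linear part of \<open>[v] - [w]\<close> is \<open>v - w\<close>.\<close>

lemma tensor_incl_diff:
  assumes v: "v \<in> carrier V" and w: "w \<in> carrier V"
    and d: "tensor_incl K V v \<ominus>\<^bsub>T\<^esub> tensor_incl K V w \<in> higher_tensors"
  shows "v = w"
proof -
  interpret F: module K F by (rule F_module)
  have sv: "single K [v] \<in> carrier F" "single K [w] \<in> carrier F" using v w by (auto intro: single_F)
  have "tensor_incl K V v \<ominus>\<^bsub>T\<^esub> tensor_incl K V w = tensor_algebra_ideal K V +>\<^bsub>F\<^esub> (single K [v] \<ominus>\<^bsub>F\<^esub> single K [w])"
    unfolding tensor_incl_def word_def tensor_algebra_def
    by (rule coset_minus[OF F_module ideal_submodule[OF F_unital tensor_ideal(1)] sv])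
  then have "single K [v] \<ominus>\<^bsub>F\<^esub> single K [w] \<in> higher"
    using d quotient_ideal_iff[OF F_unital tensor_ideal(1) higher_ideal tensor_ideal(2) F.minus_closed[OF sv]] by simp
  then have "v \<ominus>\<^bsub>V\<^esub> w = \<zero>\<^bsub>V\<^esub>"
    using v w sv by (simp add: higher_def low_degree_minus linear_part_word)
  moreover have "(v \<ominus>\<^bsub>V\<^esub> w) \<oplus>\<^bsub>V\<^esub> w = v" using v w by (simp add: M.minus_eq M.a_assoc M.l_neg)
  ultimately show ?thesis using w by simp
qed

lemma tensor_power_higher:
  assumes "n \<ge> 2" shows "tensor_power K V n \<subseteq> higher_tensors"
proof -
  have "word K V xs \<in> higher_tensors" if "xs \<in> lists (carrier V)" "length xs = n" for xs
  proof -
    have "single K xs [] = \<zero>\<^bsub>K\<^esub>" using assms that(2) by (auto simp: single_def)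
    then have "single K xs \<in> higher"
      using single_F[OF that(1)] that(2) assms by (simp add: higher_def linear_part_word)
    then show ?thesis by (simp add: word_def)
  qed
  then show ?thesis
    unfolding tensor_power_def span_of_def
    using ideal_submodule[OF T_unital higher_tensors_ideal] by blast
qed

lemma prim_higher: "carrier (prim K V c) \<subseteq> higher_tensors"
proof -
  have "prim_degree K V c n \<subseteq> higher_tensors" if "n \<ge> 2" for n
    using tensor_power_higher[OF that] by (auto simp: prim_degree_def)
  then have "(\<Union>n\<in>{2..}. prim_degree K V c n) \<subseteq> higher_tensors" by auto
  then show ?thesis
    unfolding prim_def Let_def span_of_def
    using ideal_submodule[OF T_unital higher_tensors_ideal] by auto
qed

lemma prim_module: "module K (prim K V c)"
proof -
  have "tensor_power K V n \<subseteq> carrier T" for n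
    unfolding tensor_power_def span_of_def
    using module.carrier_is_submodule[OF T_module] word_closed by blast
  then have "(\<Union>n\<in>{2..}. prim_degree K V c n) \<subseteq> carrier T" by (auto simp: prim_degree_def)
  then show ?thesis
    unfolding prim_def Let_def
    by (intro submodule.submodule_is_module span_submodule T_module)
qed

lemma enveloping_incl_inj: "inj_on (enveloping_incl K V c (\<lambda>_. \<zero>\<^bsub>V\<^esub>)) (carrier V)"
proof (rule inj_onI)
  fix v w assume v: "v \<in> carrier V" and w: "w \<in> carrier V"
    and eq: "enveloping_incl K V c (\<lambda>_. \<zero>\<^bsub>V\<^esub>) v = enveloping_incl K V c (\<lambda>_. \<zero>\<^bsub>V\<^esub>) w"
  interpret T: ring T by (rule T_ring)
  interpret H: ideal higher_tensors T by (rule higher_tensors_ideal)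
  let ?S = "(\<lambda>x. x \<ominus>\<^bsub>T\<^esub> tensor_incl K V \<zero>\<^bsub>V\<^esub>) ` carrier (prim K V c)"
  let ?J = "enveloping_ideal K V c (\<lambda>_. \<zero>\<^bsub>V\<^esub>)"
  have J: "?J = Idl\<^bsub>T\<^esub> ?S" by (simp add: enveloping_ideal_def Let_def)
  have S: "?S \<subseteq> higher_tensors"
    using prim_higher tensor_incl_zero by (auto simp: T.minus_eq intro!: H.a_closed H.a_inv_closed)
  have "?S \<subseteq> carrier T" using S H.Icarr by blast
  then have "ideal ?J T" unfolding J by (rule T.genideal_ideal)
  then have "submodule ?J K T" by (rule ideal_submodule[OF T_unital])
  then have "tensor_incl K V v \<ominus>\<^bsub>T\<^esub> tensor_incl K V w \<in> ?J"
    using eq v w tensor_incl_closed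
    by (intro coset_eq_imp_diff[OF T_module]) (auto simp: enveloping_incl_def)
  moreover have "?J \<subseteq> higher_tensors" unfolding J by (rule T.genideal_minimal[OF higher_tensors_ideal S])
  ultimately show "v = w" using tensor_incl_diff[OF v w] by blast
qed

end

lemma evaluation_exists:
  fixes V :: "('k, 'v) module"
  assumes "module K V" obtains ev where "evaluation K V ev"
proof -
  interpret module K V by fact
  have "(\<lambda>v. v) \<in> carrier V \<rightarrow> carrier V" by simp
  from free_lift[OF R.is_cring assms this] obtain ev where
    "ev \<in> carrier (free_module K (carrier V)) \<rightarrow> carrier V"
    "\<And>f g. f \<in> carrier (free_module K (carrier V)) \<Longrightarrow> g \<in> carrier (free_module K (carrier V)) \<Longrightarrow>
       ev (f \<oplus>\<^bsub>free_module K (carrier V)\<^esub> g) = ev f \<oplus>\<^bsub>V\<^esub> ev g"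
    "\<And>a f. a \<in> carrier K \<Longrightarrow> f \<in> carrier (free_module K (carrier V)) \<Longrightarrow>
       ev (a \<odot>\<^bsub>free_module K (carrier V)\<^esub> f) = a \<odot>\<^bsub>V\<^esub> ev f"
    "\<And>v. v \<in> carrier V \<Longrightarrow> ev (single K v) = v" by blast
  then have "evaluation K V ev"
    by unfold_locales (auto simp: free_module_simps)
  then show thesis by (rule that)
qed


section \<open>The zero bracket\<close>

lemma zero_linear_map:
  assumes "module K V" "module K W"
  shows "restrict (\<lambda>_. \<zero>\<^bsub>W\<^esub>) (carrier V) \<in> linear_maps K V W"
proof -
  interpret V: module K V by fact
  interpret W: module K W by fact
  show ?thesis by (auto simp: linear_maps_def)
qed

text \<open>The homogeneity relation with scalar \<open>0\<close> says that the generator \<open>(0, w)\<close> is a relation itself;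
  likewise \<open>(v, 0)\<close>.\<close>

lemma pure_tensor_zero:
  fixes V :: "('k, 'v) module" and W :: "('k, 'w) module"
  assumes V: "module K V" and W: "module K W"
  shows "w \<in> carrier W \<Longrightarrow> pure_tensor K V W \<zero>\<^bsub>V\<^esub> w = \<zero>\<^bsub>tensor K V W\<^esub>"
    and "v \<in> carrier V \<Longrightarrow> pure_tensor K V W v \<zero>\<^bsub>W\<^esub> = \<zero>\<^bsub>tensor K V W\<^esub>"
proof -
  interpret V: module K V by fact
  interpret W: module K W by fact
  let ?F = "free_module K (carrier V \<times> carrier W)"
  interpret F: module K ?F by (rule free_module_module[OF V.R.is_cring])
  interpret N: abelian_subgroup "tensor_subspace K V W" ?F
    by (rule submodule_abelian_subgroup[OF F.module_axioms tensor_sub(2)[OF V W]])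
  have zero: "pure_tensor K V W v w = \<zero>\<^bsub>tensor K V W\<^esub>"
    if vw: "v \<in> carrier V" "w \<in> carrier W"
      and r: "single K (v, w) \<ominus>\<^bsub>?F\<^esub> \<zero>\<^bsub>K\<^esub> \<odot>\<^bsub>?F\<^esub> single K (v, w) \<in> tensor_relations K V W" for v w
  proof -
    have s: "single K (v, w) \<in> carrier ?F" using vw by (intro single_closed[OF V.R.is_cring]) auto
    have m: "\<ominus>\<^bsub>?F\<^esub> \<zero>\<^bsub>?F\<^esub> = \<zero>\<^bsub>?F\<^esub>" by (rule F.M.minus_equality) simp_all
    have "single K (v, w) \<ominus>\<^bsub>?F\<^esub> \<zero>\<^bsub>K\<^esub> \<odot>\<^bsub>?F\<^esub> single K (v, w) = single K (v, w)"
      by (simp only: F.smult_l_null[OF s] a_minus_def m F.M.r_zero[OF s])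
    then have "single K (v, w) \<in> tensor_subspace K V W"
      using subsetD[OF tensor_sub(3)[OF V W] r] by (simp only:)
    then show ?thesis
      by (simp add: pure_tensor_def tensor_def quotient_simps N.a_rcos_const)
  qed
  show "pure_tensor K V W \<zero>\<^bsub>V\<^esub> w = \<zero>\<^bsub>tensor K V W\<^esub>" if w: "w \<in> carrier W"
  proof (rule zero[OF V.M.zero_closed w])
    have "single K (a \<odot>\<^bsub>V\<^esub> v, w) \<ominus>\<^bsub>?F\<^esub> a \<odot>\<^bsub>?F\<^esub> single K (v, w) \<in> tensor_relations K V W"
      if "a \<in> carrier K" "v \<in> carrier V" for a v
      unfolding tensor_relations_def Let_def by (rule UnI1, rule UnI2) (use that w in blast)
    from this[OF V.R.zero_closed V.M.zero_closed]
    show "single K (\<zero>\<^bsub>V\<^esub>, w) \<ominus>\<^bsub>?F\<^esub> \<zero>\<^bsub>K\<^esub> \<odot>\<^bsub>?F\<^esub> single K (\<zero>\<^bsub>V\<^esub>, w) \<in> tensor_relations K V W"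
      by (simp only: V.smult_l_null[OF V.M.zero_closed])
  qed
  show "pure_tensor K V W v \<zero>\<^bsub>W\<^esub> = \<zero>\<^bsub>tensor K V W\<^esub>" if v: "v \<in> carrier V"
  proof (rule zero[OF v W.M.zero_closed])
    have "single K (v, a \<odot>\<^bsub>W\<^esub> w) \<ominus>\<^bsub>?F\<^esub> a \<odot>\<^bsub>?F\<^esub> single K (v, w) \<in> tensor_relations K V W"
      if "a \<in> carrier K" "w \<in> carrier W" for a w
      unfolding tensor_relations_def Let_def by (rule UnI2) (use that v in blast)
    from this[OF V.R.zero_closed W.M.zero_closed]
    show "single K (v, \<zero>\<^bsub>W\<^esub>) \<ominus>\<^bsub>?F\<^esub> \<zero>\<^bsub>K\<^esub> \<odot>\<^bsub>?F\<^esub> single K (v, \<zero>\<^bsub>W\<^esub>) \<in> tensor_relations K V W"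
      by (simp only: W.smult_l_null[OF W.M.zero_closed])
  qed
qed

text \<open>The zero map has the property that characterises \<open>f \<otimes> g\<close>, because that property
  prescribes the values on pure tensors only.\<close>

lemma tensor_map_zero:
  assumes "module K V" "module K W" "module K V'" "module K W'"
    and z: "\<And>v w. v \<in> carrier V \<Longrightarrow> w \<in> carrier W \<Longrightarrow>
      pure_tensor K V' W' (f v) (g w) = \<zero>\<^bsub>tensor K V' W'\<^esub>"
    and t: "t \<in> carrier (tensor K V W)"
  shows "tensor_map K V W V' W' f g t = \<zero>\<^bsub>tensor K V' W'\<^esub>"
proof -
  interpret V: module K V by fact
  interpret W: module K W by fact
  let ?U = "tensor K V' W'"
  have mU: "module K ?U" by (rule pure_tensor_props(1)[OF assms(3,4)])
  interpret U: module K ?U by (rule mU)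
  have mT: "module K (tensor K V W)" by (rule pure_tensor_props(1)[OF assms(1,2)])
  note z0 = zero_linear_map[OF mT mU]
  have "tensor_map K V W V' W' f g \<in> linear_maps K (tensor K V W) ?U \<and>
    (\<forall>v\<in>carrier V. \<forall>w\<in>carrier W. tensor_map K V W V' W' f g (pure_tensor K V W v w) = pure_tensor K V' W' (f v) (g w))"
    unfolding tensor_map_def
    by (rule tensor_lift_exists[OF assms(1,2) mU]) (simp_all add: z)
  then have "tensor_map K V W V' W' f g = restrict (\<lambda>_. \<zero>\<^bsub>?U\<^esub>) (carrier (tensor K V W))"
    by (intro tensor_lift_unique[OF assms(1,2) mU _ z0])
      (simp_all add: z pure_tensor_props(2)[OF assms(1,2)])
  then show ?thesis using t by simp
qed

lemma zero_braided_bracket: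
  fixes V :: "('k, 'v) module"
  assumes bv: "braided_vector_space K V c"
  shows "braided_bracket K V c (\<lambda>_. \<zero>\<^bsub>V\<^esub>)"
proof -
  let ?E = "prim K V c" and ?VV = "tensor K V V" and ?b = "\<lambda>_. \<zero>\<^bsub>V\<^esub>"
  have V: "module K V" and lin: "is_linear K ?VV ?VV c"
    using bv by (auto simp: braided_vector_space_def)
  obtain ev where "evaluation K V ev" using evaluation_exists[OF V] .
  then have E: "module K ?E" by (rule evaluation.prim_module)
  interpret VV: module K ?VV by (rule pure_tensor_props(1)[OF V V])
  interpret V: module K V by (rule V)
  \<comment> \<open>linearity of \<open>c\<close> is given as membership of its restriction in \<open>linear_maps\<close>; \<open>c 0 = 0\<close> is the case \<open>a = 0\<close>
    of homogeneity\<close>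
  have c0: "c \<zero>\<^bsub>?VV\<^esub> = \<zero>\<^bsub>?VV\<^esub>"
  proof -
    let ?r = "restrict c (carrier ?VV)"
    have r: "?r \<in> linear_maps K ?VV ?VV" using lin by (simp add: is_linear_def)
    then have "?r \<zero>\<^bsub>?VV\<^esub> \<in> carrier ?VV" "?r (\<zero>\<^bsub>K\<^esub> \<odot>\<^bsub>?VV\<^esub> \<zero>\<^bsub>?VV\<^esub>) = \<zero>\<^bsub>K\<^esub> \<odot>\<^bsub>?VV\<^esub> ?r \<zero>\<^bsub>?VV\<^esub>"
      unfolding linear_maps_def using VV.R.zero_closed VV.M.zero_closed by blast+
    then show ?thesis by simp
  qed
  have EV: "tensor_map K ?E V V V ?b (\<lambda>v. v) t = \<zero>\<^bsub>?VV\<^esub>" if "t \<in> carrier (tensor K ?E V)" for t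
    using tensor_map_zero[OF E V V V pure_tensor_zero(1)[OF V V] that] by simp
  have VE: "tensor_map K V ?E V V (\<lambda>v. v) ?b t = \<zero>\<^bsub>?VV\<^esub>" if "t \<in> carrier (tensor K V ?E)" for t
    using tensor_map_zero[OF V E V V pure_tensor_zero(2)[OF V V] that] by simp
  have "is_linear K ?E V ?b" unfolding is_linear_def by (rule zero_linear_map[OF E V])
  then show ?thesis
    unfolding braided_bracket_def Let_def
    by (auto simp: braiding_EV_def braiding_VE_def Let_def EV VE c0)
qed

theorem proposition5p7:
  fixes K :: "('k, 'r) ring_scheme"
    and V :: "('k, 'v) module"
    and c :: "('k, 'v, 'v) tens \<Rightarrow> ('k, 'v, 'v) tens"
  assumes "field K"
    and "braided_vector_space K V c"
  shows "braided_lie_algebra K V c (\<lambda>_. \<zero>\<^bsub>V\<^esub>)"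
proof -
  have "module K V" using assms(2) by (simp add: braided_vector_space_def)
  then obtain ev where "evaluation K V ev" by (rule evaluation_exists)
  then have "inj_on (enveloping_incl K V c (\<lambda>_. \<zero>\<^bsub>V\<^esub>)) (carrier V)"
    by (rule evaluation.enveloping_incl_inj)
  then show ?thesis
    using assms(2) zero_braided_bracket[OF assms(2)] by (simp add: braided_lie_algebra_def)
qed

end
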